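(* Let $a<b<c$ be positive integers. There is an integer $N$ such that for every integer $j\ge N$ the following holds: $(j,j+a,j+b,j+c)$ is a complete intersection sequence if and only if there exist non-negative integers $m,k,\beta,\gamma$ such that $j=cm$, $k\neq 1$, and one of the following two sets of conditions is satisfied: (1a) $\gcd(b,c)=k$ and (1b) $ka=\beta b+\gamma c$; or (2a) $\gcd(a,c)=k$ and (2b) $kb=\beta a+\gamma c$ with $\beta+\gamma\le k$.
   Context: Let $K$ be a field of characteristic zero. A strictly increasing sequence of positive integers $(e_0,\ldots,e_r)$ is called a complete intersection sequence if the ring $K[t^{e_0},\ldots,t^{e_r}]$ is a complete intersection, i.e. the kernel $I$ of the $K$-algebra map $K[x_0,\ldots,x_r]\to K[t]$, $x_i\mapsto t^{e_i}$ (the defining ideal of the monomial curve $(t^{e_0},\ldots,t^{e_r})$, an ideal of height $r$), can be generated by $r$ elements.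
   Formalization: The formal theorem additionally assumes gcd(a,b,c)=1; without it the claim fails, e.g. for (a,b,c)=(2,4,6) and large j=6m, where k=2 satisfies (1a),(1b) but (j,j+2,j+4,j+6) is not a complete intersection sequence. *)

theory Defs
  imports
    "HOL-Algebra.Ideal"
    "HOL-Library.Poly_Mapping"
    "HOL-Computational_Algebra.Polynomial"
begin

(* A monomial is its finitely supported exponent vector over the variables x_0, x_1, ...;
   a polynomial is a finitely supported coefficient function on monomials, and the library
   multiplication on poly_mapping is the convolution product. *)
type_synonym 'k mpoly = "(nat \<Rightarrow>\<^sub>0 nat) \<Rightarrow>\<^sub>0 'k"

definition mpoly_ring :: "nat \<Rightarrow> 'k::field_char_0 mpoly ring" where
  "mpoly_ring n =
     \<lparr>carrier = {p. \<forall>m \<in> Poly_Mapping.keys p. Poly_Mapping.keys m \<subseteq> {..<n}},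
      monoid.mult = (*), one = 1, ring.zero = 0, add = (+)\<rparr>"

definition curve_map :: "nat list \<Rightarrow> 'k::field_char_0 mpoly \<Rightarrow> 'k poly" where
  "curve_map e p =
     (\<Sum>m \<in> Poly_Mapping.keys p.
        smult (Poly_Mapping.lookup p m)
          (\<Prod>i \<in> Poly_Mapping.keys m. monom 1 (e ! i) ^ Poly_Mapping.lookup m i))"

definition defining_ideal :: "nat list \<Rightarrow> 'k::field_char_0 mpoly set" where
  "defining_ideal e = {p \<in> carrier (mpoly_ring (length e)). curve_map e p = 0}"

(* The sequence (e_0, ..., e_r) is a list of length r + 1.  The type argument carries the
   base field; the r generators are given as a list, so repetitions are harmless. *)
definition ci_sequence :: "'k::field_char_0 itself \<Rightarrow> nat list \<Rightarrow> bool" where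
  "ci_sequence _ e \<longleftrightarrow>
     e \<noteq> [] \<and> sorted_wrt (<) e \<and> (\<forall>x \<in> set e. 0 < x) \<and>
     (\<exists>gs :: 'k mpoly list.
        length gs = length e - 1 \<and>
        set gs \<subseteq> carrier (mpoly_ring (length e)) \<and>
        defining_ideal e = Idl\<^bsub>mpoly_ring (length e)\<^esub> (set gs))"

lemma mpoly_ring_sel [simp]:
  "carrier (mpoly_ring n) = {p. \<forall>m \<in> Poly_Mapping.keys p. Poly_Mapping.keys m \<subseteq> {..<n}}"
  "x \<otimes>\<^bsub>mpoly_ring n\<^esub> y = x * y" "x \<oplus>\<^bsub>mpoly_ring n\<^esub> y = x + y"
  "\<one>\<^bsub>mpoly_ring n\<^esub> = 1" "\<zero>\<^bsub>mpoly_ring n\<^esub> = 0"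
  by (auto simp: mpoly_ring_def)

lemma mpoly_add_closed:
  "x \<in> carrier (mpoly_ring n) \<Longrightarrow> y \<in> carrier (mpoly_ring n) \<Longrightarrow> x + y \<in> carrier (mpoly_ring n)"
  using Poly_Mapping.keys_add[of x y] by auto

lemma mpoly_mult_closed:
  assumes "x \<in> carrier (mpoly_ring n)" "y \<in> carrier (mpoly_ring n)"
  shows "x * y \<in> carrier (mpoly_ring n)"
proof -
  have "Poly_Mapping.keys m \<subseteq> {..<n}" if "m \<in> Poly_Mapping.keys (x * y)" for m
  proof -
    from that obtain a b where "m = a + b" "a \<in> Poly_Mapping.keys x" "b \<in> Poly_Mapping.keys y"
      using keys_mult[of x y] by blast
    moreover from this have "Poly_Mapping.keys a \<subseteq> {..<n}" "Poly_Mapping.keys b \<subseteq> {..<n}"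
      using assms by auto
    ultimately show ?thesis using Poly_Mapping.keys_add[of a b] by blast
  qed
  then show ?thesis by simp
qed

lemma cring_mpoly_ring: "cring (mpoly_ring n :: 'k::field_char_0 mpoly ring)"
  (is "cring ?R")
proof (rule cringI)
  show "abelian_group ?R"
  proof (rule abelian_groupI)
    fix x assume "x \<in> carrier ?R"
    then have "- x \<in> carrier ?R" by simp
    then show "\<exists>y \<in> carrier ?R. y \<oplus>\<^bsub>?R\<^esub> x = \<zero>\<^bsub>?R\<^esub>"
      by (intro bexI[of _ "- x"]) auto
  next
    fix x y :: "'k mpoly" assume "x \<in> carrier ?R" "y \<in> carrier ?R"
    then show "x \<oplus>\<^bsub>?R\<^esub> y \<in> carrier ?R"
      using mpoly_add_closed[of x n y] by (simp only: mpoly_ring_sel)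
  qed (auto simp: algebra_simps)
  show "comm_monoid ?R"
  proof (rule comm_monoidI)
    fix x y :: "'k mpoly" assume "x \<in> carrier ?R" "y \<in> carrier ?R"
    then show "x \<otimes>\<^bsub>?R\<^esub> y \<in> carrier ?R"
      using mpoly_mult_closed[of x n y] by (simp only: mpoly_ring_sel)
  qed (auto simp: algebra_simps)
qed (auto simp: algebra_simps)

(* curve_map e is the K-algebra homomorphism sending x_i to t^(e_i) *)
lemma curve_map_eq:
  assumes "finite A" "Poly_Mapping.keys p \<subseteq> A"
  shows "curve_map e p =
     (\<Sum>m \<in> A. smult (Poly_Mapping.lookup p m)
          (\<Prod>i \<in> Poly_Mapping.keys m. monom 1 (e ! i) ^ Poly_Mapping.lookup m i))"
  unfolding curve_map_def
  by (rule sum.mono_neutral_left) (use assms in \<open>auto simp: in_keys_iff\<close>)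

lemma curve_map_add: "curve_map e (p + q) = curve_map e p + curve_map e q"
proof -
  let ?A = "Poly_Mapping.keys p \<union> Poly_Mapping.keys q"
  have "Poly_Mapping.keys (p + q) \<subseteq> ?A" by (rule Poly_Mapping.keys_add)
  then show ?thesis
    by (simp add: curve_map_eq[of ?A] lookup_add smult_add_left sum.distrib)
qed

lemma curve_map_single:
  "curve_map e (Poly_Mapping.single m c) =
     smult c (\<Prod>i \<in> Poly_Mapping.keys m. monom 1 (e ! i) ^ Poly_Mapping.lookup m i)"
  by (subst curve_map_eq[of "{m}"]) auto

lemma curve_map_var:
  "curve_map e (Poly_Mapping.single (Poly_Mapping.single i 1) 1) = monom 1 (e ! i)"
  by (simp add: curve_map_single)

lemma curve_map_const: "curve_map e (Poly_Mapping.single 0 c) = [:c:]"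
  by (simp add: curve_map_single)

lemma curve_map_monomial_add:
  "(\<Prod>i \<in> Poly_Mapping.keys (m + m'). monom (1::'k::field_char_0) (e ! i) ^ Poly_Mapping.lookup (m + m') i) =
   (\<Prod>i \<in> Poly_Mapping.keys m. monom 1 (e ! i) ^ Poly_Mapping.lookup m i) *
   (\<Prod>i \<in> Poly_Mapping.keys m'. monom 1 (e ! i) ^ Poly_Mapping.lookup m' i)"
proof -
  let ?A = "Poly_Mapping.keys m \<union> Poly_Mapping.keys m'"
  have ext: "(\<Prod>i \<in> Poly_Mapping.keys u. monom (1::'k) (e ! i) ^ Poly_Mapping.lookup u i) =
      (\<Prod>i \<in> ?A. monom 1 (e ! i) ^ Poly_Mapping.lookup u i)"
    if "Poly_Mapping.keys u \<subseteq> ?A" for u :: "nat \<Rightarrow>\<^sub>0 nat"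
    by (rule prod.mono_neutral_left) (use that in \<open>auto simp: in_keys_iff\<close>)
  have "Poly_Mapping.keys (m + m') \<subseteq> ?A" by (rule Poly_Mapping.keys_add)
  from ext[OF this] ext[OF Un_upper1] ext[OF Un_upper2] show ?thesis
    by (simp only: lookup_add power_add prod.distrib)
qed

lemma curve_map_mult: "curve_map e (p * q) = curve_map e p * curve_map e q"
proof -
  have zero: "curve_map e (0 :: 'a mpoly) = 0" by (simp add: curve_map_def)
  have step: "curve_map e (Poly_Mapping.single m c * r) =
      curve_map e (Poly_Mapping.single m c) * curve_map e r" for m and c :: 'a and r
  proof (induction r rule: update_induct)
    case const
    then show ?case by (simp add: zero)
  next
    case (update f a b)
    have "Poly_Mapping.update a b f = f + Poly_Mapping.single a b"
      using update by (intro poly_mapping_eqI) (auto simp: lookup_update lookup_add lookup_single in_keys_iff)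
    then show ?case
      using update
      by (simp add: distrib_left curve_map_add mult_single curve_map_single
          curve_map_monomial_add mult.commute)
  qed
  show ?thesis
  proof (induction p rule: update_induct)
    case const
    then show ?case by (simp add: zero)
  next
    case (update f a b)
    have "Poly_Mapping.update a b f = f + Poly_Mapping.single a b"
      using update by (intro poly_mapping_eqI) (auto simp: lookup_update lookup_add lookup_single in_keys_iff)
    then show ?case
      using update by (simp only: distrib_right curve_map_add step)
  qed
qed

end

theory Submission
  imports Defs
begin

text \<open>
  If \<open>I\<close> is the defining ideal and \<open>\<mm>\<close> the ideal of the variables, an ideal with \<open>r\<close> generators has
  \<open>I / \<mm>I\<close> of dimension at most \<open>r\<close>. Summing coefficients over a union of connected components of a
  fibre (monomials of equal weight, joined when they share a variable) gives a functional on
  \<open>I / \<mm>I\<close>, so for a complete intersection any \<open>r + 1\<close> of these functionals are dependent.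

  Applied to the minimal pure powers \<open>x_i ^ d_i\<close> that also lie in the semigroup generated by the other
  exponents, with \<open>j > c^2\<close> forcing the fibres of \<open>x_1 ^ d_1\<close> and \<open>x_2 ^ d_2\<close> to be homogeneous, this
  shows that \<open>x_0 ^ d_0\<close> and \<open>x_3 ^ d_3\<close> form a fibre on their own, that one of the two middle
  powers is congruent to a monomial in \<open>x_0, x_3\<close>, and that the three binomials found this way
  generate the relation lattice. The total degree modulo \<open>d_0 - d_3\<close> then gives \<open>j = c d_3\<close>, and the
  exponent of the other middle variable gives the gcd relation. Conversely, under the conditions the
  three binomials rewrite every monomial to a normal form determined by its weight.
\<close>

section \<open>Weights of monomials and the defining ideal\<close>

lemma poly_mapping_sum_monomials:
  "(\<Sum>m\<in>Poly_Mapping.keys p. Poly_Mapping.single m (Poly_Mapping.lookup p m)) = p"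
  by (rule poly_mapping_eqI) (simp add: lookup_sum lookup_single when_def in_keys_iff)

definition monomials :: "nat \<Rightarrow> (nat \<Rightarrow>\<^sub>0 nat) set" where
  "monomials n = {m. Poly_Mapping.keys m \<subseteq> {..<n}}"

text \<open>The exponent of \<open>t\<close> in the image of the monomial under
  \<open>curve_map\<close>; two monomials have the same image iff their weights agree.\<close>

definition weight :: "nat list \<Rightarrow> (nat \<Rightarrow>\<^sub>0 nat) \<Rightarrow> nat" where
  "weight e m = (\<Sum>i\<in>Poly_Mapping.keys m. Poly_Mapping.lookup m i * e ! i)"

lemma monomials_0 [simp]: "0 \<in> monomials n"
  by (simp add: monomials_def)

lemma monomials_single [simp]: "i < n \<Longrightarrow> Poly_Mapping.single i k \<in> monomials n"
  by (auto simp: monomials_def)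

lemma monomials_add [simp]: "m \<in> monomials n \<Longrightarrow> m' \<in> monomials n \<Longrightarrow> m + m' \<in> monomials n"
  using Poly_Mapping.keys_add[of m m'] by (auto simp: monomials_def)

lemma monomials_addD:
  fixes m m' :: "nat \<Rightarrow>\<^sub>0 nat"
  assumes "m + m' \<in> monomials n"
  shows "m \<in> monomials n"
  using assms by (auto simp: monomials_def in_keys_iff lookup_add subset_iff)

lemma weight_superset:
  assumes "finite A" "Poly_Mapping.keys m \<subseteq> A"
  shows "weight e m = (\<Sum>i\<in>A. Poly_Mapping.lookup m i * e ! i)"
  unfolding weight_def
  by (rule sum.mono_neutral_left) (use assms in \<open>auto simp: in_keys_iff\<close>)

lemma weight_0 [simp]: "weight e 0 = 0"
  by (simp add: weight_def)

lemma weight_single [simp]: "weight e (Poly_Mapping.single i k) = k * e ! i"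
  by (subst weight_superset[of "{i}"]) auto

lemma weight_add [simp]: "weight e (m + m') = weight e m + weight e m'"
proof -
  let ?A = "Poly_Mapping.keys m \<union> Poly_Mapping.keys m'"
  have "Poly_Mapping.keys (m + m') \<subseteq> ?A" by (rule Poly_Mapping.keys_add)
  then show ?thesis
    by (simp add: weight_superset[of ?A] lookup_add algebra_simps sum.distrib)
qed

lemma monomial_split:
  fixes m :: "nat \<Rightarrow>\<^sub>0 nat"
  assumes "i \<in> Poly_Mapping.keys m"
  obtains m' where "m = m' + Poly_Mapping.single i 1"
proof
  show "m = (m - Poly_Mapping.single i 1) + Poly_Mapping.single i 1"
    using assms
    by (intro poly_mapping_eqI)
      (auto simp: lookup_add lookup_minus lookup_single when_def in_keys_iff)
qed

lemma monomial_split_power: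
  fixes m :: "nat \<Rightarrow>\<^sub>0 nat"
  assumes "m \<in> monomials n"
  obtains m' where "m = Poly_Mapping.single i (Poly_Mapping.lookup m i) + m'"
    "i \<notin> Poly_Mapping.keys m'" "m' \<in> monomials n"
proof
  let ?m' = "m - Poly_Mapping.single i (Poly_Mapping.lookup m i)"
  show "m = Poly_Mapping.single i (Poly_Mapping.lookup m i) + ?m'"
    by (intro poly_mapping_eqI) (auto simp: lookup_add lookup_minus lookup_single when_def)
  then show "?m' \<in> monomials n"
    using assms by (metis monomials_addD add.commute)
  show "i \<notin> Poly_Mapping.keys ?m'"
    by (simp add: in_keys_iff lookup_minus)
qed

lemma prod_monom_power:
  "finite A \<Longrightarrow> (\<Prod>i\<in>A. monom (1::'k::comm_semiring_1) (f i) ^ g i) = monom 1 (\<Sum>i\<in>A. g i * f i)"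
  by (induction A rule: finite_induct) (auto simp: mult_monom monom_power mult.commute)

lemma curve_map_weight:
  "curve_map e p = (\<Sum>m\<in>Poly_Mapping.keys p. monom (Poly_Mapping.lookup p m) (weight e m))"
  unfolding curve_map_def by (simp add: prod_monom_power smult_monom weight_def)

lemma curve_map_diff: "curve_map e (p - q) = curve_map e p - curve_map e q"
  using curve_map_add[of e "p - q" q] by simp

lemma curve_map_monomial: "curve_map e (Poly_Mapping.single m x) = monom x (weight e m)"
  by (cases "x = 0") (simp_all add: curve_map_weight)

text \<open>The coefficient of \<open>t^s\<close> in \<open>curve_map e p\<close> is the sum of the
  coefficients of \<open>p\<close> at monomials of weight \<open>s\<close>, so these sums vanish,
  and an additive \<open>\<psi> s\<close> sends 0 to 0. The target is any abelian group because both
  scalar and polynomial values occur later.\<close>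

lemma additive_on_zero_curve:
  fixes \<psi> :: "nat \<Rightarrow> 'k::field_char_0 \<Rightarrow> 'b::ab_group_add"
  assumes zero: "curve_map e p = 0"
    and add: "\<And>s x y. \<psi> s (x + y) = \<psi> s x + \<psi> s y"
  shows "(\<Sum>m\<in>Poly_Mapping.keys p. \<psi> (weight e m) (Poly_Mapping.lookup p m)) = 0"
proof -
  have \<psi>0: "\<psi> s 0 = 0" for s
    using add[of s 0 0] by simp
  have hom: "(\<Sum>m\<in>A. \<psi> s (f m)) = \<psi> s (\<Sum>m\<in>A. f m)" if "finite A" for s A and f :: "_ \<Rightarrow> 'k"
    using that by (induction A rule: finite_induct) (auto simp: \<psi>0 add)
  have coeff: "(\<Sum>m\<in>{m \<in> Poly_Mapping.keys p. weight e m = s}. Poly_Mapping.lookup p m) = 0" for s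
  proof -
    have "0 = coeff (curve_map e p) s" by (simp add: zero)
    also have "\<dots> = (\<Sum>m\<in>Poly_Mapping.keys p. if weight e m = s then Poly_Mapping.lookup p m else 0)"
      by (simp add: curve_map_weight coeff_sum)
    also have "\<dots> = (\<Sum>m\<in>{m \<in> Poly_Mapping.keys p. weight e m = s}. Poly_Mapping.lookup p m)"
      by (rule sum.inter_filter[symmetric]) simp
    finally show ?thesis by simp
  qed
  have "(\<Sum>m\<in>Poly_Mapping.keys p. \<psi> (weight e m) (Poly_Mapping.lookup p m)) =
      (\<Sum>s\<in>weight e ` Poly_Mapping.keys p.
        \<Sum>m\<in>{m \<in> Poly_Mapping.keys p. weight e m = s}. \<psi> (weight e m) (Poly_Mapping.lookup p m))"
    by (rule sum.image_gen) simp
  also have "\<dots> = (\<Sum>s\<in>weight e ` Poly_Mapping.keys p. 0)"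
  proof (rule sum.cong[OF refl])
    fix s
    have "(\<Sum>m\<in>{m \<in> Poly_Mapping.keys p. weight e m = s}. \<psi> (weight e m) (Poly_Mapping.lookup p m))
        = (\<Sum>m\<in>{m \<in> Poly_Mapping.keys p. weight e m = s}. \<psi> s (Poly_Mapping.lookup p m))"
      by (rule sum.cong) auto
    also have "\<dots> = 0" by (subst hom) (auto simp: coeff \<psi>0)
    finally show "(\<Sum>m\<in>{m \<in> Poly_Mapping.keys p. weight e m = s}.
        \<psi> (weight e m) (Poly_Mapping.lookup p m)) = 0" .
  qed
  finally show ?thesis by simp
qed

section \<open>Ideals of the polynomial ring and generation of the kernel by binomials\<close>

lemma carrier_iff: "p \<in> carrier (mpoly_ring n) \<longleftrightarrow> Poly_Mapping.keys p \<subseteq> monomials n"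
  by (auto simp: monomials_def)

lemma keys_diff_subset:
  fixes p q :: "'a \<Rightarrow>\<^sub>0 'b::ab_group_add"
  shows "Poly_Mapping.keys (p - q) \<subseteq> Poly_Mapping.keys p \<union> Poly_Mapping.keys q"
  by (auto simp: in_keys_iff lookup_minus)

text \<open>Additive inverses are multiples by \<open>- 1\<close>, which lies in the ring, so
  closure under sums and multiples suffices.\<close>

lemma ideal_mpolyI:
  fixes J :: "'k::field_char_0 mpoly set"
  assumes "J \<subseteq> carrier (mpoly_ring n)" "0 \<in> J"
    and "\<And>p q. p \<in> J \<Longrightarrow> q \<in> J \<Longrightarrow> p + q \<in> J"
    and mult: "\<And>h p. h \<in> carrier (mpoly_ring n) \<Longrightarrow> p \<in> J \<Longrightarrow> h * p \<in> J"
  shows "ideal J (mpoly_ring n)"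
proof -
  let ?R = "mpoly_ring n :: 'k mpoly ring"
  interpret cring ?R by (rule cring_mpoly_ring)
  have neg: "\<ominus>\<^bsub>?R\<^esub> p \<in> J" if "p \<in> J" for p
  proof -
    have p: "p \<in> carrier ?R" using that assms(1) by blast
    have "\<ominus>\<^bsub>?R\<^esub> p = (\<ominus>\<^bsub>?R\<^esub> \<one>\<^bsub>?R\<^esub>) \<otimes>\<^bsub>?R\<^esub> p"
      using p by (simp only: l_minus one_closed l_one)
    also have "\<dots> = (\<ominus>\<^bsub>?R\<^esub> \<one>\<^bsub>?R\<^esub>) * p" by simp
    finally show ?thesis using mult[OF a_inv_closed[OF one_closed] that] by simp
  qed
  have "subgroup J (add_monoid ?R)"
    by (rule add.subgroupI) (use assms neg in \<open>auto simp: a_inv_def\<close>)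
  moreover have "p * h \<in> J" if "h \<in> carrier ?R" "p \<in> J" for h p
    using mult[OF that] by (simp only: mult.commute)
  ultimately show ?thesis
    using mult by (intro idealI ring_axioms) simp_all
qed

lemma ideal_mpolyD:
  fixes J :: "'k::field_char_0 mpoly set"
  assumes "ideal J (mpoly_ring n)"
  shows "0 \<in> J" "\<And>p q. p \<in> J \<Longrightarrow> q \<in> J \<Longrightarrow> p + q \<in> J"
    "\<And>h p. h \<in> carrier (mpoly_ring n) \<Longrightarrow> p \<in> J \<Longrightarrow> h * p \<in> J"
proof -
  interpret ideal J "mpoly_ring n :: 'k mpoly ring" by (rule assms)
  show "0 \<in> J" using additive_subgroup.zero_closed[OF additive_subgroup_axioms] by simp
  show "p + q \<in> J" if "p \<in> J" "q \<in> J" for p q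
    using additive_subgroup.a_closed[OF additive_subgroup_axioms that] by simp
  show "h * p \<in> J" if "h \<in> carrier (mpoly_ring n)" "p \<in> J" for h p
    using I_l_closed[OF that(2,1)] by simp
qed

lemma ideal_defining_ideal: "ideal (defining_ideal e :: 'k::field_char_0 mpoly set) (mpoly_ring (length e))"
proof (rule ideal_mpolyI)
  fix p q :: "'k mpoly" assume "p \<in> defining_ideal e" "q \<in> defining_ideal e"
  then show "p + q \<in> defining_ideal e"
    unfolding defining_ideal_def using mpoly_add_closed[of p _ q] by (auto simp: curve_map_add simp del: mpoly_ring_sel)
next
  fix h p :: "'k mpoly" assume "h \<in> carrier (mpoly_ring (length e))" "p \<in> defining_ideal e"
  then show "h * p \<in> defining_ideal e"
    unfolding defining_ideal_def using mpoly_mult_closed[of h _ p] by (auto simp: curve_map_mult simp del: mpoly_ring_sel)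
qed (auto simp: defining_ideal_def curve_map_def)

lemma binomial_in_defining_ideal:
  assumes "m \<in> monomials (length e)" "m' \<in> monomials (length e)" "weight e m = weight e m'"
  shows "Poly_Mapping.single m 1 - Poly_Mapping.single m' 1 \<in> (defining_ideal e :: 'k::field_char_0 mpoly set)"
proof -
  have "Poly_Mapping.keys (Poly_Mapping.single m 1 - Poly_Mapping.single m' 1 :: 'k mpoly) \<subseteq> {m, m'}"
    using keys_diff_subset by fastforce
  then show ?thesis
    using assms unfolding defining_ideal_def
    by (auto simp: carrier_iff curve_map_diff curve_map_monomial simp del: mpoly_ring_sel)
qed

text \<open>With one monomial fixed per weight, an element of the kernel is a combination of
  differences between its own monomials and the fixed ones.\<close>

lemma defining_ideal_subset_ideal:
  fixes J :: "'k::field_char_0 mpoly set"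
  assumes J: "ideal J (mpoly_ring (length e))"
    and bin: "\<And>m m'. m \<in> monomials (length e) \<Longrightarrow> m' \<in> monomials (length e) \<Longrightarrow>
        weight e m = weight e m' \<Longrightarrow> Poly_Mapping.single m 1 - Poly_Mapping.single m' 1 \<in> J"
  shows "defining_ideal e \<subseteq> J"
proof
  fix p :: "'k mpoly" assume p: "p \<in> defining_ideal e"
  let ?M = "monomials (length e)"
  define \<sigma> where "\<sigma> s = (SOME m. m \<in> ?M \<and> weight e m = s)" for s
  have \<sigma>: "\<sigma> (weight e m) \<in> ?M" "weight e (\<sigma> (weight e m)) = weight e m" if "m \<in> ?M" for m
    using someI[of "\<lambda>m'. m' \<in> ?M \<and> weight e m' = weight e m" m] that by (auto simp: \<sigma>_def)
  have keys: "Poly_Mapping.keys p \<subseteq> ?M" and zero: "curve_map e p = 0"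
    using p by (auto simp: defining_ideal_def carrier_iff simp del: mpoly_ring_sel)
  have sumJ: "(\<Sum>m\<in>A. f m) \<in> J" if "finite A" "\<And>m. m \<in> A \<Longrightarrow> f m \<in> J" for A and f :: "_ \<Rightarrow> 'k mpoly"
    using that by (induction A rule: finite_induct) (auto intro: ideal_mpolyD[OF J])
  have "p = (\<Sum>m\<in>Poly_Mapping.keys p. Poly_Mapping.single m (Poly_Mapping.lookup p m))"
    by (simp add: poly_mapping_sum_monomials)
  \<comment> \<open>The subtracted sum is zero: for each weight it gathers the coefficients of
    \<open>p\<close> at a single monomial, where they add up to 0.\<close>
  also have "\<dots> = (\<Sum>m\<in>Poly_Mapping.keys p. Poly_Mapping.single m (Poly_Mapping.lookup p m))
      - (\<Sum>m\<in>Poly_Mapping.keys p. Poly_Mapping.single (\<sigma> (weight e m)) (Poly_Mapping.lookup p m))"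
    using additive_on_zero_curve[OF zero, of "\<lambda>s. Poly_Mapping.single (\<sigma> s)"]
    by (simp add: single_add)
  also have "\<dots> = (\<Sum>m\<in>Poly_Mapping.keys p. Poly_Mapping.single 0 (Poly_Mapping.lookup p m) *
      (Poly_Mapping.single m 1 - Poly_Mapping.single (\<sigma> (weight e m)) 1))"
    by (simp add: sum_subtractf right_diff_distrib mult_single)
  also have "\<dots> \<in> J"
  proof (rule sumJ)
    fix m assume "m \<in> Poly_Mapping.keys p"
    then have "m \<in> ?M" using keys by blast
    then show "Poly_Mapping.single 0 (Poly_Mapping.lookup p m) *
      (Poly_Mapping.single m 1 - Poly_Mapping.single (\<sigma> (weight e m)) 1) \<in> J"
      by (intro ideal_mpolyD[OF J] bin) (auto simp: \<sigma>)
  qed simp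
  finally show "p \<in> J" .
qed

section \<open>Functionals on the ideal modulo the ideal of the variables\<close>

definition lin :: "('a \<Rightarrow> 'k) \<Rightarrow> ('a \<Rightarrow>\<^sub>0 'k) \<Rightarrow> 'k::comm_ring_1" where
  "lin \<chi> p = (\<Sum>m\<in>Poly_Mapping.keys p. \<chi> m * Poly_Mapping.lookup p m)"

lemma lin_superset:
  assumes "finite A" "Poly_Mapping.keys p \<subseteq> A"
  shows "lin \<chi> p = (\<Sum>m\<in>A. \<chi> m * Poly_Mapping.lookup p m)"
  unfolding lin_def
  by (rule sum.mono_neutral_left) (use assms in \<open>auto simp: in_keys_iff\<close>)

lemma lin_0 [simp]: "lin \<chi> 0 = 0"
  by (simp add: lin_def)

lemma lin_single [simp]: "lin \<chi> (Poly_Mapping.single m x) = \<chi> m * x"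
  by (subst lin_superset[of "{m}"]) auto

lemma lin_add: "lin \<chi> (p + q) = lin \<chi> p + lin \<chi> q"
proof -
  let ?A = "Poly_Mapping.keys p \<union> Poly_Mapping.keys q"
  have "Poly_Mapping.keys (p + q) \<subseteq> ?A" by (rule Poly_Mapping.keys_add)
  then show ?thesis
    by (simp add: lin_superset[of ?A] lookup_add algebra_simps sum.distrib)
qed

lemma lin_diff: "lin \<chi> (p - q) = lin \<chi> p - lin \<chi> q"
  using lin_add[of \<chi> "p - q" q] by simp

lemma lin_sum: "lin \<chi> (\<Sum>x\<in>A. f x) = (\<Sum>x\<in>A. lin \<chi> (f x))"
  by (induction A rule: infinite_finite_induct) (auto simp: lin_add)

lemma lin_mult:
  fixes p q :: "('a::cancel_comm_monoid_add) \<Rightarrow>\<^sub>0 'k::comm_ring_1"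
  shows "lin \<chi> (p * q) = (\<Sum>m\<in>Poly_Mapping.keys p.
    Poly_Mapping.lookup p m * lin (\<lambda>n. \<chi> (m + n)) q)"
proof -
  have "p * q = (\<Sum>m\<in>Poly_Mapping.keys p. Poly_Mapping.single m (Poly_Mapping.lookup p m)) *
      (\<Sum>n\<in>Poly_Mapping.keys q. Poly_Mapping.single n (Poly_Mapping.lookup q n))"
    by (simp add: poly_mapping_sum_monomials)
  also have "\<dots> = (\<Sum>m\<in>Poly_Mapping.keys p. \<Sum>n\<in>Poly_Mapping.keys q.
      Poly_Mapping.single (m + n) (Poly_Mapping.lookup p m * Poly_Mapping.lookup q n))"
    by (simp add: sum_product mult_single)
  finally have "lin \<chi> (p * q) = (\<Sum>m\<in>Poly_Mapping.keys p. \<Sum>n\<in>Poly_Mapping.keys q.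
      \<chi> (m + n) * (Poly_Mapping.lookup p m * Poly_Mapping.lookup q n))"
    by (simp add: lin_sum)
  then show ?thesis
    by (simp add: lin_def[of _ q] sum_distrib_left mult_ac)
qed

text \<open>The functionals \<open>lin \<chi>\<close> that vanish on \<open>\<mm>I\<close>: a multiple of \<open>x_i\<close> is seen only through its image in \<open>K[t]\<close>.\<close>

definition fibre_functional :: "nat list \<Rightarrow> ((nat \<Rightarrow>\<^sub>0 nat) \<Rightarrow> 'k) \<Rightarrow> bool" where
  "fibre_functional e \<chi> \<longleftrightarrow> (\<forall>i<length e. \<forall>m\<in>monomials (length e). \<forall>m'\<in>monomials (length e).
     weight e m = weight e m' \<longrightarrow>
     \<chi> (m + Poly_Mapping.single i 1) = \<chi> (m' + Poly_Mapping.single i 1))"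

text \<open>For a nonconstant monomial \<open>m\<close>, \<open>\<chi> (m + n)\<close> depends only
  on the weight of \<open>n\<close>, so its sum against an element of the kernel vanishes. Only the
  constant term of \<open>h\<close> survives.\<close>

lemma lin_mult_defining_ideal:
  fixes \<chi> :: "(nat \<Rightarrow>\<^sub>0 nat) \<Rightarrow> 'k::field_char_0"
  assumes \<chi>: "fibre_functional e \<chi>" and g: "g \<in> defining_ideal e"
    and h: "h \<in> carrier (mpoly_ring (length e))"
  shows "lin \<chi> (h * g) = Poly_Mapping.lookup h 0 * lin \<chi> g"
proof -
  let ?M = "monomials (length e)"
  have gM: "Poly_Mapping.keys g \<subseteq> ?M" and g0: "curve_map e g = 0"
    using g by (auto simp: defining_ideal_def carrier_iff simp del: mpoly_ring_sel)
  have vanish: "lin (\<lambda>n. \<chi> (m + n)) g = 0" if m: "m \<in> ?M" "m \<noteq> 0" for m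
  proof -
    obtain i where i: "i \<in> Poly_Mapping.keys m" using m(2) by (metis poly_mapping_eqI lookup_zero in_keys_iff)
    then obtain m' where m': "m = m' + Poly_Mapping.single i 1" by (rule monomial_split)
    have "m' \<in> ?M" using m(1) m' by (metis monomials_addD)
    have "i < length e" using i m(1) by (auto simp: monomials_def)
    \<comment> \<open>The value of \<open>\<chi> (m + n)\<close> at a chosen \<open>n\<close> of
      weight \<open>s\<close>; peeling \<open>x_i\<close> off \<open>m\<close> shows that the choice
      does not matter.\<close>
    define \<psi> where "\<psi> s = \<chi> (m + (SOME n. n \<in> ?M \<and> weight e n = s))" for s
    have \<psi>: "\<chi> (m + n) = \<psi> (weight e n)" if "n \<in> ?M" for n
    proof -
      define n' where "n' = (SOME n'. n' \<in> ?M \<and> weight e n' = weight e n)"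
      have "n' \<in> ?M \<and> weight e n' = weight e n"
        unfolding n'_def by (rule someI[of _ n]) (use that in simp)
      then have "\<chi> (m' + n + Poly_Mapping.single i 1) = \<chi> (m' + n' + Poly_Mapping.single i 1)"
        using \<chi> \<open>i < length e\<close> \<open>m' \<in> ?M\<close> that unfolding fibre_functional_def by auto
      then show ?thesis unfolding \<psi>_def n'_def[symmetric] m' by (simp only: add_ac)
    qed
    have "lin (\<lambda>n. \<chi> (m + n)) g =
        (\<Sum>n\<in>Poly_Mapping.keys g. \<psi> (weight e n) * Poly_Mapping.lookup g n)"
      unfolding lin_def by (rule sum.cong) (use gM \<psi> in auto)
    also have "\<dots> = 0"
      using additive_on_zero_curve[OF g0, of "\<lambda>s x. \<psi> s * x"] by (simp add: distrib_left)
    finally show ?thesis .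
  qed
  have "lin \<chi> (h * g) = (\<Sum>m\<in>Poly_Mapping.keys h. if m = 0 then Poly_Mapping.lookup h 0 * lin \<chi> g else 0)"
    unfolding lin_mult
    by (rule sum.cong) (use h vanish in \<open>auto simp: carrier_iff simp del: mpoly_ring_sel\<close>)
  also have "\<dots> = Poly_Mapping.lookup h 0 * lin \<chi> g"
    by (auto simp: sum.delta' in_keys_iff)
  finally show ?thesis .
qed

text \<open>\<open>n + 1\<close> vectors in an \<open>n\<close>-dimensional space are dependent:
  Gaussian elimination on the last coordinate lowers the dimension by one.\<close>

lemma nontrivial_linear_relation:
  fixes v :: "nat \<Rightarrow> nat \<Rightarrow> 'k::field"
  shows "\<exists>l. (\<exists>i\<le>n. l i \<noteq> 0) \<and> (\<forall>j<n. (\<Sum>i\<le>n. l i * v i j) = 0)"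
proof (induction n arbitrary: v)
  case 0
  show ?case by (rule exI[of _ "\<lambda>_. 1"]) simp
next
  case (Suc n)
  show ?case
  proof (cases "v (Suc n) n = 0")
    case False
    \<comment> \<open>Row \<open>Suc n\<close> is the pivot: its multiples clear the last coordinate
      of the other rows, and its own coefficient is then solved for.\<close>
    define p where "p = v (Suc n) n"
    define w where "w i j = v i j - v i n / p * v (Suc n) j" for i j
    obtain l where l: "\<exists>i\<le>n. l i \<noteq> 0" "\<And>j. j < n \<Longrightarrow> (\<Sum>i\<le>n. l i * w i j) = 0"
      using Suc[of w] by blast
    have wn: "w i n = 0" for i using False by (simp add: w_def p_def)
    define l' where "l' i = (if i \<le> n then l i else - (\<Sum>i\<le>n. l i * v i n) / p)" for i
    have "(\<Sum>i\<le>Suc n. l' i * v i j) = 0" if "j < Suc n" for j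
    proof -
      have "(\<Sum>i\<le>Suc n. l' i * v i j) = (\<Sum>i\<le>n. l i * v i j) - (\<Sum>i\<le>n. l i * v i n) / p * v (Suc n) j"
        by (simp add: l'_def)
      also have "\<dots> = (\<Sum>i\<le>n. l i * w i j)"
        by (simp add: w_def right_diff_distrib sum_subtractf sum_distrib_right sum_divide_distrib mult.assoc)
      also have "\<dots> = 0" using that l(2)[of j] wn by (cases "j = n") auto
      finally show ?thesis .
    qed
    moreover have "\<exists>i\<le>Suc n. l' i \<noteq> 0" using l(1) by (auto simp: l'_def)
    ultimately show ?thesis by blast
  next
    case True
    show ?thesis
    proof (cases "\<exists>r\<le>n. v r n \<noteq> 0")
      case False
      \<comment> \<open>The last coordinate vanishes on every row, so the first \<open>n + 1\<close>
        rows already satisfy a relation.\<close>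
      obtain l where l: "\<exists>i\<le>n. l i \<noteq> 0" "\<And>j. j < n \<Longrightarrow> (\<Sum>i\<le>n. l i * v i j) = 0"
        using Suc[of v] by blast
      define l' where "l' i = (if i \<le> n then l i else 0)" for i
      have "(\<Sum>i\<le>Suc n. l' i * v i j) = 0" if "j < Suc n" for j
      proof -
        have "(\<Sum>i\<le>Suc n. l' i * v i j) = (\<Sum>i\<le>n. l i * v i j)" by (simp add: l'_def)
        also have "\<dots> = 0" using that l(2)[of j] False by (cases "j = n") auto
        finally show ?thesis .
      qed
      moreover have "\<exists>i\<le>Suc n. l' i \<noteq> 0" using l(1) by (auto simp: l'_def)
      ultimately show ?thesis by blast
    next
      case r: True
      then obtain r where r: "r \<le> n" "v r n \<noteq> 0" by blast
      \<comment> \<open>Row \<open>r\<close> is the pivot and yields its place to row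
        \<open>Suc n\<close>, whose last coordinate is 0; the remaining rows are cleared with the
        pivot.\<close>
      define w where "w i j = (if i = r then v (Suc n) j else v i j - v i n / v r n * v r j)" for i j
      obtain l where l: "\<exists>i\<le>n. l i \<noteq> 0" "\<And>j. j < n \<Longrightarrow> (\<Sum>i\<le>n. l i * w i j) = 0"
        using Suc[of w] by blast
      have wn: "w i n = 0" for i using r True by (simp add: w_def)
      \<comment> \<open>The total multiple of row \<open>r\<close> that was subtracted; its negative
        becomes the coefficient of that row.\<close>
      define q where "q = (\<Sum>i\<in>{..n} - {r}. l i * (v i n / v r n))"
      define l' where "l' i = (if i = Suc n then l r else if i = r then - q else l i)" for i
      have "(\<Sum>i\<le>Suc n. l' i * v i j) = 0" if "j < Suc n" for j
      proof -
        have "(\<Sum>i\<le>Suc n. l' i * v i j) = (\<Sum>i\<in>{..n} - {r}. l i * v i j) - q * v r j + l r * v (Suc n) j"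
          using r by (subst sum.atMost_Suc, subst sum.remove[of _ r])
            (auto simp: l'_def algebra_simps intro!: sum.cong)
        also have "\<dots> = (\<Sum>i\<in>{..n} - {r}. l i * w i j) + l r * w r j"
          by (simp add: w_def q_def right_diff_distrib sum_subtractf sum_distrib_right mult.assoc)
        also have "\<dots> = (\<Sum>i\<le>n. l i * w i j)"
          using r by (subst sum.remove[of "{..n}" r]) auto
        also have "\<dots> = 0" using that l(2)[of j] wn by (cases "j = n") auto
        finally show ?thesis .
      qed
      moreover have "\<exists>i\<le>Suc n. l' i \<noteq> 0"
      proof -
        obtain i where i: "i \<le> n" "l i \<noteq> 0" using l(1) by blast
        then have "l' (if i = r then Suc n else i) \<noteq> 0" by (auto simp: l'_def)
        then show ?thesis using i(1) by (intro exI[of _ "if i = r then Suc n else i"]) auto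
      qed
      ultimately show ?thesis by blast
    qed
  qed
qed

text \<open>There is one functional more than there are generators, so a nontrivial combination
  kills every generator. Its zero set in the defining ideal is again an ideal, hence everything, and
  evaluation on binomials gives the relation.\<close>

lemma ci_sequence_relation:
  fixes \<chi> :: "nat \<Rightarrow> (nat \<Rightarrow>\<^sub>0 nat) \<Rightarrow> 'k::field_char_0"
  assumes ci: "ci_sequence TYPE('k) e"
    and \<chi>: "\<And>i. i < length e \<Longrightarrow> fibre_functional e (\<chi> i)"
  obtains l where "\<exists>i<length e. l i \<noteq> 0"
    "\<And>m m'. m \<in> monomials (length e) \<Longrightarrow> m' \<in> monomials (length e) \<Longrightarrow> weight e m = weight e m' \<Longrightarrow>
       (\<Sum>i<length e. l i * \<chi> i m) = (\<Sum>i<length e. l i * \<chi> i m')"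
proof -
  let ?R = "mpoly_ring (length e) :: 'k mpoly ring" and ?I = "defining_ideal e :: 'k mpoly set"
  interpret R: cring ?R by (rule cring_mpoly_ring)
  obtain gs :: "'k mpoly list" where gs: "length gs = length e - 1" "set gs \<subseteq> carrier ?R"
      "?I = Idl\<^bsub>?R\<^esub> (set gs)" and "e \<noteq> []"
    using ci unfolding ci_sequence_def by blast
  then have len: "{..length gs} = {..<length e}" by (cases e) auto
  have gsI: "set gs \<subseteq> ?I" using R.genideal_self[OF gs(2)] gs(3) by simp
  obtain l where l: "\<exists>i\<le>length gs. l i \<noteq> 0"
      "\<And>j. j < length gs \<Longrightarrow> (\<Sum>i\<le>length gs. l i * lin (\<chi> i) (gs ! j)) = 0"
    using nontrivial_linear_relation[of "length gs" "\<lambda>i j. lin (\<chi> i) (gs ! j)"] by blast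
  define \<Phi> where "\<Phi> m = (\<Sum>i<length e. l i * \<chi> i m)" for m
  have lin\<Phi>: "lin \<Phi> p = (\<Sum>i<length e. l i * lin (\<chi> i) p)" for p
    unfolding lin_def \<Phi>_def sum_distrib_left sum_distrib_right
    by (subst sum.swap) (simp add: mult.assoc)
  have \<Phi>: "fibre_functional e \<Phi>"
    unfolding fibre_functional_def
  proof (intro allI ballI impI)
    fix i m m'
    assume "i < length e" "m \<in> monomials (length e)" "m' \<in> monomials (length e)" "weight e m = weight e m'"
    then have "\<chi> k (m + Poly_Mapping.single i 1) = \<chi> k (m' + Poly_Mapping.single i 1)" if "k < length e" for k
      using \<chi>[OF that] unfolding fibre_functional_def by blast
    then show "\<Phi> (m + Poly_Mapping.single i 1) = \<Phi> (m' + Poly_Mapping.single i 1)"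
      unfolding \<Phi>_def by (intro sum.cong) auto
  qed
  have "?I \<subseteq> carrier ?R" unfolding defining_ideal_def by blast
  \<comment> \<open>\<open>lin \<Phi> (h * g)\<close> is a scalar multiple of
    \<open>lin \<Phi> g\<close>, so the zero set is closed under multiples.\<close>
  then have "ideal {p \<in> ?I. lin \<Phi> p = 0} ?R"
    by (intro ideal_mpolyI)
      (auto simp: lin_add lin_mult_defining_ideal[OF \<Phi>] ideal_mpolyD[OF ideal_defining_ideal]
        simp del: mpoly_ring_sel)
  moreover have "lin \<Phi> g = 0" if "g \<in> set gs" for g
    using that l(2) by (auto simp: lin\<Phi> len in_set_conv_nth)
  ultimately have "?I \<subseteq> {p \<in> ?I. lin \<Phi> p = 0}"
    using gsI unfolding gs(3) by (intro R.genideal_minimal) auto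
  then have "\<Phi> m = \<Phi> m'"
    if "m \<in> monomials (length e)" "m' \<in> monomials (length e)" "weight e m = weight e m'" for m m'
    using binomial_in_defining_ideal[OF that, where 'k='k] by (auto simp: lin_diff)
  moreover have "\<exists>i<length e. l i \<noteq> 0"
    using l(1) len by (auto simp flip: lessThan_iff atMost_iff)
  ultimately show ?thesis
    using that[of l] unfolding \<Phi>_def by blast
qed

text \<open>In the graph on a fibre that joins monomials sharing a variable, \<open>m\<close> is a
  connected component by itself.\<close>

definition isolated :: "nat list \<Rightarrow> (nat \<Rightarrow>\<^sub>0 nat) \<Rightarrow> bool" where
  "isolated e m \<longleftrightarrow> m \<in> monomials (length e) \<and> (\<forall>m'\<in>monomials (length e).
     weight e m' = weight e m \<longrightarrow> m' \<noteq> m \<longrightarrow> Poly_Mapping.keys m' \<inter> Poly_Mapping.keys m = {})"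

text \<open>Two multiples of \<open>x_i\<close> share a variable; if they have equal weight and one
  of them is \<open>m\<close>, then so is the other.\<close>

lemma isolated_fibre_functional:
  assumes "isolated e m"
  shows "fibre_functional e (\<lambda>n. of_bool (n = m))"
proof -
  have *: "n' + Poly_Mapping.single i 1 = m"
    if "i < length e" "n \<in> monomials (length e)" "n' \<in> monomials (length e)" "weight e n = weight e n'"
      "n + Poly_Mapping.single i 1 = m" for i n n'
  proof -
    have "i \<in> Poly_Mapping.keys (n' + Poly_Mapping.single i 1)" "i \<in> Poly_Mapping.keys m"
      by (simp_all add: in_keys_iff lookup_add flip: that(5))
    moreover have "n' + Poly_Mapping.single i 1 \<in> monomials (length e)"
      "weight e (n' + Poly_Mapping.single i 1) = weight e m"
      using that(1-4) by (simp_all flip: that(5))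
    ultimately show ?thesis using assms unfolding isolated_def by blast
  qed
  show ?thesis
    unfolding fibre_functional_def
  proof (intro allI ballI impI)
    fix i n n'
    assume "i < length e" "n \<in> monomials (length e)" "n' \<in> monomials (length e)" "weight e n = weight e n'"
    then have "(n + Poly_Mapping.single i 1 = m) = (n' + Poly_Mapping.single i 1 = m)"
      using *[of i n n'] *[of i n' n] by auto
    then show "of_bool (n + Poly_Mapping.single i 1 = m) = of_bool (n' + Poly_Mapping.single i 1 = m)"
      by simp
  qed
qed

text \<open>The functional \<open>\<chi>\<close> and the \<open>r\<close> indicators of the
  \<open>P i\<close> are dependent. On the pairs \<open>P k\<close>, \<open>Q k\<close> the
  indicators give a triangular matrix while \<open>\<chi>\<close> gives 0, so every indicator has
  coefficient 0 and \<open>\<chi>\<close> has not.\<close>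

lemma ci_sequence_fibre_functional_constant:
  fixes \<chi> :: "(nat \<Rightarrow>\<^sub>0 nat) \<Rightarrow> 'k::field_char_0"
  assumes ci: "ci_sequence TYPE('k) e" and len: "length e = Suc r"
    and iso: "\<And>i. i < r \<Longrightarrow> isolated e (P i)"
    and Q: "\<And>i. i < r \<Longrightarrow> Q i \<in> monomials (length e)" "\<And>i. i < r \<Longrightarrow> weight e (P i) = weight e (Q i)"
      "\<And>i. i < r \<Longrightarrow> P i \<noteq> Q i"
    and tri: "\<And>i k. i < k \<Longrightarrow> k < r \<Longrightarrow> P i \<noteq> P k \<and> P i \<noteq> Q k"
    and \<chi>: "fibre_functional e \<chi>" "\<And>i. i < r \<Longrightarrow> \<chi> (P i) = \<chi> (Q i)"
    and m: "m \<in> monomials (length e)" "m' \<in> monomials (length e)" "weight e m = weight e m'"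
  shows "\<chi> m = \<chi> m'"
proof -
  define \<chi>' where "\<chi>' i = (case i of 0 \<Rightarrow> \<chi> | Suc k \<Rightarrow> (\<lambda>n. of_bool (n = P k)))" for i
  have "fibre_functional e (\<chi>' i)" if "i < length e" for i
    using that \<chi>(1) iso isolated_fibre_functional by (cases i) (auto simp: \<chi>'_def len)
  then obtain l where l: "\<exists>i<length e. l i \<noteq> 0" and
      rel: "\<And>m m'. m \<in> monomials (length e) \<Longrightarrow> m' \<in> monomials (length e) \<Longrightarrow> weight e m = weight e m' \<Longrightarrow>
       (\<Sum>i<length e. l i * \<chi>' i m) = (\<Sum>i<length e. l i * \<chi>' i m')"
    using ci_sequence_relation[OF ci, of \<chi>'] by blast
  have split: "(\<Sum>i<length e. l i * \<chi>' i n) = l 0 * \<chi> n + (\<Sum>i<r. l (Suc i) * of_bool (n = P i))" for n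
    by (simp add: len sum.lessThan_Suc_shift \<chi>'_def del: sum.lessThan_Suc)
  have zero: "l (Suc k) = 0" if "k < r" for k
  proof (rule ccontr)
    define S where "S = {k. k < r \<and> l (Suc k) \<noteq> 0}"
    assume "l (Suc k) \<noteq> 0"
    then have S: "finite S" "S \<noteq> {}" using that by (auto simp: S_def)
    \<comment> \<open>On the pair of the last index \<open>K\<close> with nonzero coefficient,
      earlier indicators vanish by \<open>tri\<close>, later ones have coefficient 0, and the
      indicator of \<open>P K\<close> contributes \<open>l (Suc K)\<close>.\<close>
    define K where "K = Max S"
    have K: "K < r" "l (Suc K) \<noteq> 0" using Max_in[OF S] by (auto simp: S_def K_def)
    have above: "l (Suc i) = 0" if "K < i" "i < r" for i
      using Max_ge[OF S(1), of i] that unfolding K_def S_def by fastforce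
    have "(\<Sum>i<length e. l i * \<chi>' i (P K)) - (\<Sum>i<length e. l i * \<chi>' i (Q K)) = 0"
      using rel[of "P K" "Q K"] iso[OF K(1)] Q[OF K(1)] by (auto simp: isolated_def)
    then have "0 = (\<Sum>i<r. l (Suc i) * (of_bool (P K = P i) - of_bool (Q K = P i)))"
      unfolding split using \<chi>(2)[OF K(1)]
      by (simp only: right_diff_distrib sum_subtractf add_diff_cancel_left)
    also have "\<dots> = (\<Sum>i<r. if i = K then l (Suc K) else 0)"
    proof (rule sum.cong[OF refl])
      fix i assume "i \<in> {..<r}"
      then show "l (Suc i) * (of_bool (P K = P i) - of_bool (Q K = P i)) = (if i = K then l (Suc K) else 0)"
        using tri[of i K] above[of i] K Q(3)[of K] by (cases i K rule: linorder_cases) auto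
    qed
    also have "\<dots> = l (Suc K)" using K by simp
    finally show False using K(2) by simp
  qed
  have eq: "(\<Sum>i<length e. l i * \<chi>' i n) = l 0 * \<chi> n" for n
    unfolding split by (simp add: zero)
  have "l 0 \<noteq> 0" using l zero len by (metis less_Suc_eq_0_disj)
  then show ?thesis using rel[OF m] unfolding eq by simp
qed

lemma weight_eq_0:
  assumes "m \<in> monomials (length e)" "\<forall>x\<in>set e. 0 < x" "weight e m = 0"
  shows "m = 0"
proof (rule poly_mapping_eqI)
  fix i
  show "Poly_Mapping.lookup m i = Poly_Mapping.lookup 0 i"
  proof (rule ccontr)
    assume "Poly_Mapping.lookup m i \<noteq> Poly_Mapping.lookup 0 i"
    then have i: "i \<in> Poly_Mapping.keys m" by (simp add: in_keys_iff)
    then have "Poly_Mapping.lookup m i * e ! i = 0" "i < length e"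
      using assms by (auto simp: weight_def monomials_def)
    then show False using i assms(2) by (metis in_keys_iff less_irrefl mult_is_0 nth_mem)
  qed
qed

text \<open>The least positive \<open>d\<close> for which \<open>x_i^d\<close> has the weight of a
  monomial free of \<open>x_i\<close> works: another monomial of that fibre containing
  \<open>x_i\<close> would, after cancelling its power of \<open>x_i\<close>, give a smaller such
  exponent.\<close>

lemma exists_isolated_power:
  assumes pos: "\<forall>x\<in>set e. 0 < x" and i: "i < length e"
    and N: "0 < N" "m \<in> monomials (length e)" "i \<notin> Poly_Mapping.keys m" "weight e m = N * e ! i"
  obtains d m' where "0 < d" "d \<le> N" "isolated e (Poly_Mapping.single i d)"
    "m' \<in> monomials (length e)" "i \<notin> Poly_Mapping.keys m'" "weight e m' = d * e ! i"
proof -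
  let ?Q = "\<lambda>d. 0 < d \<and> (\<exists>m'\<in>monomials (length e). i \<notin> Poly_Mapping.keys m' \<and> weight e m' = d * e ! i)"
  define d where "d = (LEAST d. ?Q d)"
  have QN: "?Q N" using N by blast
  have d: "?Q d" "d \<le> N" unfolding d_def by (rule LeastI[of ?Q, OF QN], rule Least_le[of ?Q, OF QN])
  then obtain m' where m': "m' \<in> monomials (length e)" "i \<notin> Poly_Mapping.keys m'" "weight e m' = d * e ! i"
    by blast
  have "n = Poly_Mapping.single i d"
    if n: "n \<in> monomials (length e)" "weight e n = d * e ! i" "i \<in> Poly_Mapping.keys n" for n
  proof -
    define x where "x = Poly_Mapping.lookup n i"
    obtain n' where n': "n = Poly_Mapping.single i x + n'" "i \<notin> Poly_Mapping.keys n'"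
        "n' \<in> monomials (length e)"
      using monomial_split_power[OF n(1)] unfolding x_def by metis
    have x: "0 < x" using n(3) by (simp add: x_def in_keys_iff)
    have w: "x * e ! i + weight e n' = d * e ! i" using n(2) by (simp add: n'(1))
    moreover have "0 < e ! i" using pos i by simp
    ultimately have "x \<le> d" by (metis le_add1 mult_le_cancel2)
    have w': "weight e n' = (d - x) * e ! i" using w by (simp add: diff_mult_distrib)
    have "\<not> ?Q (d - x)"
      using not_less_Least[of "d - x" ?Q] x d unfolding d_def[symmetric] by auto
    then have "d = x" using w' n' \<open>x \<le> d\<close> by fastforce
    then show ?thesis using weight_eq_0[OF n'(3) pos] w' n'(1) by simp
  qed
  then have "isolated e (Poly_Mapping.single i d)"
    unfolding isolated_def using i by auto
  then show ?thesis using that[of d m'] d m' by blast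
qed

text \<open>In effect the differences \<open>P i - Q i\<close> generate the lattice of integer
  relations between the entries of \<open>e\<close>; additive test functions modulo \<open>D\<close>
  express this without a quotient lattice.\<close>

lemma ci_sequence_invariant:
  fixes F :: "(nat \<Rightarrow>\<^sub>0 nat) \<Rightarrow> int"
  assumes ci: "ci_sequence TYPE('k::field_char_0) e" and len: "length e = Suc r"
    and iso: "\<And>i. i < r \<Longrightarrow> isolated e (P i)"
    and Q: "\<And>i. i < r \<Longrightarrow> Q i \<in> monomials (length e)" "\<And>i. i < r \<Longrightarrow> weight e (P i) = weight e (Q i)"
      "\<And>i. i < r \<Longrightarrow> P i \<noteq> Q i"
    and tri: "\<And>i k. i < k \<Longrightarrow> k < r \<Longrightarrow> P i \<noteq> P k \<and> P i \<noteq> Q k"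
    and F: "\<And>m m'. F (m + m') = F m + F m'"
    and D: "\<And>i. i < r \<Longrightarrow> D dvd F (P i) - F (Q i)"
    and m: "m \<in> monomials (length e)" "m' \<in> monomials (length e)" "weight e m = weight e m'"
  shows "D dvd F m - F m'"
  using m
  \<comment> \<open>By induction monomials sharing a variable are congruent, so the indicator of a congruence class in a fibre is a functional.\<close>
proof (induction "weight e m" arbitrary: m m' rule: less_induct)
  case less
  have pos: "\<forall>x\<in>set e. 0 < x" using ci by (simp add: ci_sequence_def)
  define \<chi> :: "(nat \<Rightarrow>\<^sub>0 nat) \<Rightarrow> 'k" where
    "\<chi> n = of_bool (weight e n = weight e m \<and> D dvd F n - F m)" for n
  have shift: "(D dvd F n - F m) = (D dvd F n' - F m)" if "D dvd F n - F n'" for n n'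
    using that dvd_diff_left_iff[of D "F n - F n'" "F n - F m"]
    by (metis add_diff_eq diff_add_cancel dvd_add_right_iff)
  have ff: "fibre_functional e \<chi>"
    unfolding fibre_functional_def
  proof (intro allI ballI impI)
    fix i n n'
    assume *: "i < length e" "n \<in> monomials (length e)" "n' \<in> monomials (length e)" "weight e n = weight e n'"
    show "\<chi> (n + Poly_Mapping.single i 1) = \<chi> (n' + Poly_Mapping.single i 1)"
    proof (cases "weight e n + e ! i = weight e m")
      case True
      then have "D dvd F n - F n'" using less.hyps[of n n'] * pos by (metis less_add_same_cancel1 nth_mem)
      then have "D dvd F (n + Poly_Mapping.single i 1) - F (n' + Poly_Mapping.single i 1)"
        by (simp add: F)
      from shift[OF this] show ?thesis using * by (simp add: \<chi>_def)
    next
      case False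
      then show ?thesis using * by (simp add: \<chi>_def)
    qed
  qed
  have eq: "\<chi> (P i) = \<chi> (Q i)" if "i < r" for i
    using shift[OF D[OF that]] Q(2)[OF that] by (simp add: \<chi>_def)
  have "\<chi> m = \<chi> m'"
    by (rule ci_sequence_fibre_functional_constant[OF ci len iso Q tri ff eq less.prems])
  then have "D dvd F m' - F m" using less.prems by (simp add: \<chi>_def split: if_splits)
  then show ?case by (simp add: dvd_diff_commute)
qed

section \<open>Necessity of the conditions for large shifts\<close>

locale shifted_curve =
  fixes a b c j :: nat
  assumes a_pos: "0 < a" and a_less_b: "a < b" and b_less_c: "b < c" and j_large: "c * c < j"
    and gcd_abc: "gcd a (gcd b c) = 1"
begin

section \<open>Degree, shift and weight for the shifted exponents\<close>

definition e :: "nat list" where "e = [j, j + a, j + b, j + c]"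

definition sh :: "nat \<Rightarrow> nat" where "sh i = [0, a, b, c] ! i"

definition deg :: "(nat \<Rightarrow>\<^sub>0 nat) \<Rightarrow> nat" where
  "deg m = (\<Sum>i<4. Poly_Mapping.lookup m i)"

definition shift :: "(nat \<Rightarrow>\<^sub>0 nat) \<Rightarrow> nat" where
  "shift m = (\<Sum>i<4. Poly_Mapping.lookup m i * sh i)"

lemma sh_simps [simp]: "sh 0 = 0" "sh 1 = a" "sh (Suc 0) = a" "sh 2 = b" "sh 3 = c"
  by (simp_all add: sh_def)

lemma length_e [simp]: "length e = 4"
  by (simp add: e_def)

lemma less_4_cases: "(i::nat) < 4 \<Longrightarrow> i = 0 \<or> i = 1 \<or> i = 2 \<or> i = 3"
  by auto

lemma sum_4: "(\<Sum>i<4. f i) = f 0 + f 1 + f 2 + f (3::nat)"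
  by (simp add: eval_nat_numeral)

lemma e_nth [simp]: "i < 4 \<Longrightarrow> e ! i = j + sh i"
  using less_4_cases[of i] by (auto simp: e_def sh_def)

lemma sh_le: "i < 4 \<Longrightarrow> sh i \<le> c"
  using less_4_cases[of i] a_less_b b_less_c by auto

lemma sh_inj: "i < 4 \<Longrightarrow> i' < 4 \<Longrightarrow> sh i = sh i' \<Longrightarrow> i = i'"
  using less_4_cases[of i] less_4_cases[of i'] a_less_b b_less_c a_pos by auto

lemma j_pos: "0 < j"
  using j_large by simp

lemma e_pos: "\<forall>x\<in>set e. 0 < x"
  using j_pos by (simp add: e_def)

text \<open>Splits the weight into a part proportional to \<open>j\<close> and a remainder
  independent of \<open>j\<close>; the size of \<open>j\<close> will keep the two apart.\<close>

lemma weight_e: "m \<in> monomials 4 \<Longrightarrow> weight e m = deg m * j + shift m"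
  unfolding deg_def shift_def
  by (subst weight_superset[of "{..<4}"])
    (auto simp: monomials_def sum_distrib_right distrib_left sum.distrib)

lemma deg_add [simp]: "deg (m + m') = deg m + deg m'"
  by (simp add: deg_def lookup_add sum.distrib)

lemma shift_add [simp]: "shift (m + m') = shift m + shift m'"
  by (simp add: shift_def lookup_add sum.distrib algebra_simps)

lemma deg_single [simp]: "i < 4 \<Longrightarrow> deg (Poly_Mapping.single i k) = k"
  by (simp add: deg_def lookup_single when_def)

lemma shift_single [simp]: "i < 4 \<Longrightarrow> shift (Poly_Mapping.single i k) = k * sh i"
  using less_4_cases[of i] by (auto simp: shift_def sum_4 lookup_single when_def)

lemma shift_le: "shift m \<le> deg m * c"
  unfolding shift_def deg_def sum_distrib_right
  by (rule sum_mono) (simp add: sh_le)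

text \<open>Since $j > c^2$, a fibre containing a monomial of degree at most $c$ is homogeneous.\<close>

lemma homogeneous_fibre:
  assumes m: "m \<in> monomials 4" "m' \<in> monomials 4" "weight e m = weight e m'" and d: "deg m \<le> c"
  shows "deg m = deg m'" "shift m = shift m'"
proof -
  have eq: "deg m * j + shift m = deg m' * j + shift m'" using m by (simp add: weight_e)
  have small: "shift n < j" if "deg n \<le> c" for n
    using shift_le[of n] that j_large by (meson le_trans mult_le_mono1 not_less)
  have "deg m' * j < (deg m + 1) * j"
    using eq small[OF d] by simp
  then have le: "deg m' \<le> deg m" by (metis Suc_eq_plus1 less_Suc_eq_le mult_less_cancel2)
  then have "deg m * j < (deg m' + 1) * j"
    using eq small[of m'] d by simp
  then have "deg m \<le> deg m'" by (metis Suc_eq_plus1 less_Suc_eq_le mult_less_cancel2)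
  then show "deg m = deg m'" using le by simp
  then show "shift m = shift m'" using eq by simp
qed

text \<open>Equal degrees make the exponents equal, equal shifts then give
  \<open>sh i = sh i'\<close>, and the four offsets are distinct.\<close>

lemma power_in_homogeneous_fibre:
  assumes i: "i < 4" "i' < 4" and w: "weight e (Poly_Mapping.single i n) = weight e (Poly_Mapping.single i' n')"
    and n: "0 < n" "n \<le> c"
  shows "i = i'"
proof -
  have "deg (Poly_Mapping.single i n) = deg (Poly_Mapping.single i' n')"
    "shift (Poly_Mapping.single i n) = shift (Poly_Mapping.single i' n')"
    using i n w by (intro homogeneous_fibre; simp)+
  then have "sh i = sh i'" using i n by simp
  then show ?thesis using i sh_inj by blast
qed

lemma pure_power_exists:
  assumes "i < 4"
  obtains d m where "0 < d" "isolated e (Poly_Mapping.single i d)" "m \<in> monomials 4"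
    "i \<notin> Poly_Mapping.keys m" "weight e m = weight e (Poly_Mapping.single i d)" "i \<in> {1, 2} \<longrightarrow> d \<le> c"
proof -
  \<comment> \<open>The witnesses are \<open>x_0^(j + c)\<close> against \<open>x_3^j\<close>, and
    for a middle variable \<open>x_i^c\<close> against \<open>x_0^(c - sh i) * x_3^(sh i)\<close>,
    which is the source of the bound \<open>d \<le> c\<close>.\<close>
  define N where "N = (if i = 0 then j + c else if i = 3 then j else c)"
  define n :: "nat \<Rightarrow>\<^sub>0 nat" where "n = (if i = 0 then Poly_Mapping.single 3 j else if i = 3 then Poly_Mapping.single 0 (j + c)
    else Poly_Mapping.single 0 (c - sh i) + Poly_Mapping.single 3 (sh i))"
  have "weight e n = N * e ! i"
  proof (cases "i = 0 \<or> i = 3")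
    case True
    then show ?thesis by (auto simp: n_def N_def)
  next
    case False
    have "(c - sh i) * j + sh i * j = c * j"
      using sh_le[OF assms] by (simp flip: add_mult_distrib)
    then show ?thesis using False assms by (simp add: n_def N_def algebra_simps)
  qed
  moreover have "0 < N" using j_pos b_less_c by (simp add: N_def)
  moreover have "i \<notin> Poly_Mapping.keys n"
    by (auto simp: n_def in_keys_iff lookup_add lookup_single when_def)
  moreover have "n \<in> monomials 4" by (simp add: n_def)
  ultimately obtain d m where "0 < d" "d \<le> N" "isolated e (Poly_Mapping.single i d)"
    "m \<in> monomials (length e)" "i \<notin> Poly_Mapping.keys m" "weight e m = d * e ! i"
    using exists_isolated_power[of e i N n] e_pos assms by auto
  moreover from this have "i \<in> {1, 2} \<Longrightarrow> d \<le> c" by (auto simp: N_def)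
  ultimately show ?thesis using that[of d m] assms by simp
qed

text \<open>The monomials are the positive and negative parts of \<open>u\<close>, cut out by
  \<open>nat\<close>. Relations built from Bezout coefficients reach the invariants this
  way.\<close>

lemma lattice_vector_monomials:
  fixes u :: "nat \<Rightarrow> int"
  assumes "(\<Sum>i<4. u i * int (e ! i)) = 0"
  obtains m m' where "m \<in> monomials 4" "m' \<in> monomials 4" "weight e m = weight e m'"
    "\<forall>i<4. int (Poly_Mapping.lookup m i) - int (Poly_Mapping.lookup m' i) = u i"
proof -
  define f where "f v = (\<Sum>i<4. Poly_Mapping.single i (nat (v i)))" for v :: "nat \<Rightarrow> int"
  have f: "f v \<in> monomials 4" "\<And>i. i < 4 \<Longrightarrow> Poly_Mapping.lookup (f v) i = nat (v i)" for v
    using less_4_cases by (auto simp: f_def sum_4 lookup_add lookup_single when_def)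
  have w: "weight e m = (\<Sum>i<4. Poly_Mapping.lookup m i * e ! i)" if "m \<in> monomials 4" for m
    using that by (intro weight_superset) (auto simp: monomials_def)
  let ?v = "\<lambda>i. - u i"
  have "int (weight e (f u)) - int (weight e (f ?v)) = (\<Sum>i<4. u i * int (e ! i))"
    unfolding w[OF f(1)] of_nat_sum sum_subtractf[symmetric]
  proof (rule sum.cong[OF refl])
    fix i :: nat assume "i \<in> {..<4}"
    then show "int (Poly_Mapping.lookup (f u) i * e ! i) - int (Poly_Mapping.lookup (f ?v) i * e ! i) = u i * int (e ! i)"
      using f(2) by (auto simp: algebra_simps)
  qed
  then show ?thesis using that[of "f u" "f ?v"] f assms by auto
qed

text \<open>The case \<open>r = 3\<close>, with the families written as explicit triples so that the
  conditions on each pair are separate premises.\<close>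

lemma sharp_fibre_functional_constant:
  fixes \<chi> :: "(nat \<Rightarrow>\<^sub>0 nat) \<Rightarrow> 'k::field_char_0"
  assumes ci: "ci_sequence TYPE('k) e"
    and iso: "isolated e P0" "isolated e P1" "isolated e P2"
    and Q: "Q0 \<in> monomials 4" "Q1 \<in> monomials 4" "Q2 \<in> monomials 4"
      "weight e Q0 = weight e P0" "weight e Q1 = weight e P1" "weight e Q2 = weight e P2"
      "P0 \<noteq> Q0" "P1 \<noteq> Q1" "P2 \<noteq> Q2"
    and tri: "P0 \<noteq> P1" "P0 \<noteq> Q1" "P0 \<noteq> P2" "P0 \<noteq> Q2" "P1 \<noteq> P2" "P1 \<noteq> Q2"
    and \<chi>: "fibre_functional e \<chi>" "\<chi> P0 = \<chi> Q0" "\<chi> P1 = \<chi> Q1" "\<chi> P2 = \<chi> Q2"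
    and m: "m \<in> monomials 4" "m' \<in> monomials 4" "weight e m = weight e m'"
  shows "\<chi> m = \<chi> m'"
proof (rule ci_sequence_fibre_functional_constant[OF ci, where r=3 and P="(!) [P0, P1, P2]" and Q="(!) [Q0, Q1, Q2]"])
  fix i k :: nat assume "i < k" "k < 3"
  then have "i = 0 \<and> k = 1 \<or> i = 0 \<and> k = 2 \<or> i = 1 \<and> k = 2" by auto
  then show "[P0, P1, P2] ! i \<noteq> [P0, P1, P2] ! k \<and> [P0, P1, P2] ! i \<noteq> [Q0, Q1, Q2] ! k"
    using tri by auto
qed (use assms in \<open>auto simp: less_Suc_eq numeral_3_eq_3\<close>)

lemma sharp_invariant:
  fixes F :: "(nat \<Rightarrow>\<^sub>0 nat) \<Rightarrow> int"
  assumes ci: "ci_sequence TYPE('k::field_char_0) e"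
    and iso: "isolated e P0" "isolated e P1" "isolated e P2"
    and Q: "Q0 \<in> monomials 4" "Q1 \<in> monomials 4" "Q2 \<in> monomials 4"
      "weight e Q0 = weight e P0" "weight e Q1 = weight e P1" "weight e Q2 = weight e P2"
      "P0 \<noteq> Q0" "P1 \<noteq> Q1" "P2 \<noteq> Q2"
    and tri: "P0 \<noteq> P1" "P0 \<noteq> Q1" "P0 \<noteq> P2" "P0 \<noteq> Q2" "P1 \<noteq> P2" "P1 \<noteq> Q2"
    and F: "\<And>m m'. F (m + m') = F m + F m'"
      "D dvd F P0 - F Q0" "D dvd F P1 - F Q1" "D dvd F P2 - F Q2"
    and m: "m \<in> monomials 4" "m' \<in> monomials 4" "weight e m = weight e m'"
  shows "D dvd F m - F m'"
proof (rule ci_sequence_invariant[OF ci, where r=3 and P="(!) [P0, P1, P2]" and Q="(!) [Q0, Q1, Q2]"])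
  fix i k :: nat assume "i < k" "k < 3"
  then have "i = 0 \<and> k = 1 \<or> i = 0 \<and> k = 2 \<or> i = 1 \<and> k = 2" by auto
  then show "[P0, P1, P2] ! i \<noteq> [P0, P1, P2] ! k \<and> [P0, P1, P2] ! i \<noteq> [Q0, Q1, Q2] ! k"
    using tri by auto
qed (use assms in \<open>auto simp: less_Suc_eq numeral_3_eq_3\<close>)

section \<open>Monomials in the outer variables \<open>x_0\<close> and \<open>x_3\<close>\<close>

abbreviation outer :: "nat \<Rightarrow> nat \<Rightarrow> nat \<Rightarrow>\<^sub>0 nat" where
  "outer i l \<equiv> Poly_Mapping.single 0 i + Poly_Mapping.single 3 l"

text \<open>The degree determines \<open>i + l\<close>, and the shift determines \<open>l\<close>
  because \<open>c\<close> is positive.\<close>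

lemma outer_unique:
  assumes "deg (outer i l) = deg (outer i' l')" "shift (outer i l) = shift (outer i' l')"
  shows "outer i l = outer i' l'"
proof -
  have "i + l = i' + l'" "l * c = l' * c" using assms by simp_all
  moreover have "0 < c" using a_pos a_less_b b_less_c by simp
  ultimately show ?thesis by simp
qed

lemma monomial_outer:
  assumes "m \<in> monomials 4" "1 \<notin> Poly_Mapping.keys m" "2 \<notin> Poly_Mapping.keys m"
  shows "m = outer (Poly_Mapping.lookup m 0) (Poly_Mapping.lookup m 3)"
proof (rule poly_mapping_eqI)
  fix i
  have "i \<in> Poly_Mapping.keys m \<Longrightarrow> i < 4" using assms(1) by (auto simp: monomials_def)
  then show "Poly_Mapping.lookup m i = Poly_Mapping.lookup (outer (Poly_Mapping.lookup m 0) (Poly_Mapping.lookup m 3)) i"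
    using less_4_cases[of i] assms(2,3)
    by (auto simp: lookup_add lookup_single when_def in_keys_iff)
qed

text \<open>Among outer monomials whose fibre involves a middle variable, one of least degree is
  taken; \<open>x_0^(c - a) * x_3^a\<close>, of the weight of \<open>x_1^c\<close>, bounds that
  degree by \<open>c\<close>. The fibre is then homogeneous, so it has no second outer monomial, and
  a variable shared with any other monomial could be cancelled to lower the degree.\<close>

lemma exists_isolated_outer:
  obtains i l m where "isolated e (outer i l)" "m \<in> monomials 4" "weight e m = weight e (outer i l)"
    "1 \<in> Poly_Mapping.keys m \<or> 2 \<in> Poly_Mapping.keys m"
proof -
  define T where "T n i l m \<longleftrightarrow> i + l = n \<and> m \<in> monomials 4 \<and> weight e m = weight e (outer i l) \<and>
    (1 \<in> Poly_Mapping.keys m \<or> 2 \<in> Poly_Mapping.keys m)" for n i l m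
  let ?Q = "\<lambda>n. \<exists>i l m. T n i l m"
  define n where "n = (LEAST n. ?Q n)"
  have "(c - a) * j + a * j = c * j"
    using a_less_b b_less_c by (simp flip: add_mult_distrib)
  then have "T c (c - a) a (Poly_Mapping.single 1 c)"
    using a_less_b b_less_c by (simp add: T_def algebra_simps)
  then have Qc: "?Q c" by blast
  have n: "?Q n" "n \<le> c"
    unfolding n_def by (rule LeastI[of ?Q, OF Qc], rule Least_le[of ?Q, OF Qc])
  then obtain i l m where m: "T n i l m" by blast
  have small: "\<not> T k i' l' m'" if "k < n" for k i' l' m'
    using not_less_Least[of k ?Q] that unfolding n_def by blast
  have "m' = outer i l"
    if m': "m' \<in> monomials 4" "weight e m' = weight e (outer i l)"
      "Poly_Mapping.keys m' \<inter> Poly_Mapping.keys (outer i l) \<noteq> {}" for m'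
  proof (cases "1 \<in> Poly_Mapping.keys m' \<or> 2 \<in> Poly_Mapping.keys m'")
    case False
    have "deg (outer i l) = deg m'" "shift (outer i l) = shift m'"
      using m n(2) m' by (intro homogeneous_fibre; simp add: T_def)+
    then show ?thesis using monomial_outer[OF m'(1)] False outer_unique by metis
  next
    case True
    obtain k where k: "k \<in> Poly_Mapping.keys m'" "k \<in> Poly_Mapping.keys (outer i l)"
      using m'(3) by blast
    obtain m'' where m'': "m' = m'' + Poly_Mapping.single k 1" using k(1) by (rule monomial_split)
    have M: "m'' \<in> monomials 4" using m'(1) m'' by (metis monomials_addD)
    \<comment> \<open>The shared variable is an outer one, so after cancelling it \<open>m''\<close>
      still contains a middle variable.\<close>
    have "k = 0 \<and> 0 < i \<or> k = 3 \<and> 0 < l"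
      using k(2) by (auto simp: in_keys_iff lookup_add lookup_single when_def split: if_splits)
    then show ?thesis
    proof
      assume k: "k = 0 \<and> 0 < i"
      then obtain i' where i': "i = Suc i'" by (cases i) auto
      have "T (n - 1) i' l m''"
        using m M m' True k by (auto simp: T_def i' m'' in_keys_iff lookup_add lookup_single)
      moreover have "n - 1 < n" using m i' by (simp add: T_def)
      ultimately show ?thesis using small by blast
    next
      assume k: "k = 3 \<and> 0 < l"
      then obtain l' where l': "l = Suc l'" by (cases l) auto
      have "T (n - 1) i l' m''"
        using m M m' True k by (auto simp: T_def l' m'' in_keys_iff lookup_add lookup_single)
      moreover have "n - 1 < n" using m l' by (simp add: T_def)
      ultimately show ?thesis using small by blast
    qed
  qed
  then have "isolated e (outer i l)"
    unfolding isolated_def by (auto simp: m)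
  then show ?thesis using that m unfolding T_def by blast
qed

section \<open>Divisibility constraints on the exponents\<close>

lemma single_eq_single_index:
  assumes "Poly_Mapping.single i (d::nat) = Poly_Mapping.single i' d'" "0 < d"
  shows "i = i'"
proof -
  have "Poly_Mapping.keys (Poly_Mapping.single i d) = Poly_Mapping.keys (Poly_Mapping.single i' d')"
    by (simp only: assms(1))
  then show ?thesis using assms(2) by (auto split: if_splits)
qed

text \<open>A Bezout relation for \<open>k = gcd (sh p) c\<close> is a lattice vector with entry
  \<open>k\<close> at \<open>x_q\<close>, so \<open>d\<close> divides \<open>k\<close> by
  \<open>inv\<close>; conversely \<open>k\<close> divides \<open>d * sh q\<close> and is coprime to
  \<open>sh q\<close>. Hence \<open>d = k\<close>, and the homogeneous relation between
  \<open>x_q^d\<close> and \<open>M\<close> is the desired one.\<close>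

lemma middle_relation:
  assumes pq: "p = 1 \<and> q = 2 \<or> p = 2 \<and> q = 1"
    and M: "M \<in> monomials 4" "q \<notin> Poly_Mapping.keys M" "weight e M = weight e (Poly_Mapping.single q d)"
    and d: "0 < d" "d \<le> c"
    and inv: "\<And>m m'. m \<in> monomials 4 \<Longrightarrow> m' \<in> monomials 4 \<Longrightarrow> weight e m = weight e m' \<Longrightarrow>
      int d dvd int (Poly_Mapping.lookup m q) - int (Poly_Mapping.lookup m' q)"
  shows "\<exists>k \<beta> \<gamma>. k \<noteq> 1 \<and> gcd (sh p) c = k \<and> k * sh q = \<beta> * sh p + \<gamma> * c \<and> \<beta> + \<gamma> \<le> k"
proof -
  define k where "k = gcd (sh p) c"
  have q: "q < 4" using pq by auto
  have hom: "deg (Poly_Mapping.single q d) = deg M" "shift (Poly_Mapping.single q d) = shift M"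
    using M d q by (intro homogeneous_fibre; simp)+
  define \<beta> \<gamma> where "\<beta> = Poly_Mapping.lookup M p" and "\<gamma> = Poly_Mapping.lookup M 3"
  have M0: "Poly_Mapping.lookup M q = 0" using M(2) by (simp add: in_keys_iff)
  have rel: "d * sh q = \<beta> * sh p + \<gamma> * c"
    using hom(2) q M0 pq by (auto simp: shift_def sum_4 \<beta>_def \<gamma>_def lookup_single)
  have le: "\<beta> + \<gamma> \<le> d"
    using hom(1) q M0 pq by (auto simp: deg_def sum_4 \<beta>_def \<gamma>_def lookup_single)
  have "gcd k (sh q) = 1"
    using gcd_abc pq by (auto simp: k_def gcd.commute gcd.left_commute gcd.assoc)
  moreover have "k dvd d * sh q" unfolding rel k_def by simp
  ultimately have kd: "k dvd d" by (simp add: coprime_dvd_mult_left_iff coprime_iff_gcd_eq_1)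
  obtain s t where st: "s * int (sh p) + t * int c = int k"
    using bezout_int[of "int (sh p)" "int c"] by (auto simp: k_def)
  \<comment> \<open>The entries at \<open>p\<close> and 3 cancel the shift \<open>k * sh q\<close>,
    and the entry at 0 makes the total degree 0.\<close>
  define u where "u i = (if i = q then int k else if i = p then - int (sh q) * s
    else if i = 3 then - int (sh q) * t else - int k + int (sh q) * s + int (sh q) * t)" for i
  have "(\<Sum>i<4. u i * int (e ! i)) = int (sh q) * (int k - (s * int (sh p) + t * int c))"
    using pq by (auto simp: sum_4 u_def algebra_simps)
  then have "(\<Sum>i<4. u i * int (e ! i)) = 0" by (simp add: st)
  then obtain m m' where "m \<in> monomials 4" "m' \<in> monomials 4" "weight e m = weight e m'"
    "\<forall>i<4. int (Poly_Mapping.lookup m i) - int (Poly_Mapping.lookup m' i) = u i"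
    by (rule lattice_vector_monomials)
  then have "int d dvd int k" using inv[of m m'] q by (simp add: u_def)
  then have "d = k" using kd by (simp add: dvd_antisym)
  \<comment> \<open>With \<open>d = 1\<close> the relation would equate \<open>sh q\<close> with 0,
    \<open>sh p\<close> or \<open>c\<close>.\<close>
  moreover have "k \<noteq> 1"
  proof
    assume "k = 1"
    then have "d = 1" using \<open>d = k\<close> by simp
    then have "\<beta> = 0 \<and> \<gamma> = 0 \<or> \<beta> = 1 \<and> \<gamma> = 0 \<or> \<beta> = 0 \<and> \<gamma> = 1" using le by auto
    then show False using rel \<open>d = 1\<close> pq a_pos a_less_b b_less_c by auto
  qed
  ultimately show ?thesis using rel le unfolding k_def by blast
qed

text \<open>Since \<open>a\<close>, \<open>b\<close>, \<open>c\<close> have gcd 1, the lattice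
  contains a vector of total degree 1. So \<open>d0\<close> and \<open>d3\<close> differ by exactly
  1, and \<open>eq\<close> rules out \<open>d3 = Suc d0\<close>.\<close>

lemma shift_multiple:
  assumes eq: "d3 * (j + c) = d0 * j"
    and inv: "\<And>m m'. m \<in> monomials 4 \<Longrightarrow> m' \<in> monomials 4 \<Longrightarrow> weight e m = weight e m' \<Longrightarrow>
      int d0 - int d3 dvd int (deg m) - int (deg m')"
  shows "j = c * d3"
proof -
  obtain s r' where 1: "s * int a + r' * int (gcd b c) = 1"
    using bezout_int[of "int a" "int (gcd b c)"] gcd_abc by (auto simp: gcd_int_int_eq)
  obtain t r where 2: "t * int b + r * int c = int (gcd b c)"
    using bezout_int[of "int b" "int c"] by auto
  \<comment> \<open>A Bezout combination for 1, scaled by \<open>- j\<close>, has shift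
    \<open>- j\<close>; the entry at 0 raises the total degree to 1, so the weight is
    \<open>j - j\<close>.\<close>
  define u where "u i = (if i = 1 then - int j * s else if i = 2 then - int j * (r' * t)
    else if i = 3 then - int j * (r' * r) else 1 + int j * (s + r' * t + r' * r))" for i :: nat
  have "(\<Sum>i<4. u i * int (e ! i)) = int j * (1 - (s * int a + r' * (t * int b + r * int c)))"
    by (simp add: sum_4 u_def algebra_simps)
  also have "\<dots> = 0" by (simp only: 1 2) simp
  finally obtain m m' where m: "m \<in> monomials 4" "m' \<in> monomials 4" "weight e m = weight e m'"
    "\<forall>i<4. int (Poly_Mapping.lookup m i) - int (Poly_Mapping.lookup m' i) = u i"
    by (rule lattice_vector_monomials)
  have "int (deg m) - int (deg m') = u 0 + u 1 + u 2 + u 3"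
    unfolding deg_def sum_4 using m(4)[rule_format, of 0] m(4)[rule_format, of 1] m(4)[rule_format, of 2] m(4)[rule_format, of 3] by simp
  also have "\<dots> = 1" by (simp add: u_def algebra_simps)
  finally have "int d0 - int d3 dvd 1" using inv[OF m(1-3)] by simp
  then have "int d0 - int d3 = 1 \<or> int d0 - int d3 = - 1" by (auto simp: zdvd1_eq)
  then have "d0 = Suc d3 \<or> d3 = Suc d0" by auto
  then show ?thesis using eq j_pos by (auto simp: algebra_simps)
qed

lemma ci_sequence_imp:
  assumes ci: "ci_sequence TYPE('k::field_char_0) e"
  shows "\<exists>m k \<beta> \<gamma>. j = c * m \<and> k \<noteq> 1 \<and>
       ((gcd b c = k \<and> k * a = \<beta> * b + \<gamma> * c) \<or>
        (gcd a c = k \<and> k * b = \<beta> * a + \<gamma> * c \<and> \<beta> + \<gamma> \<le> k))"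
proof -
  have "\<forall>i<4. \<exists>d M. 0 < d \<and> isolated e (Poly_Mapping.single i d) \<and> M \<in> monomials 4 \<and>
      i \<notin> Poly_Mapping.keys M \<and> weight e M = weight e (Poly_Mapping.single i d) \<and>
      (i = 1 \<or> i = 2 \<longrightarrow> d \<le> c)"
  proof (intro allI impI)
    fix i :: nat assume "i < 4"
    then obtain d M where "0 < d" "isolated e (Poly_Mapping.single i d)" "M \<in> monomials 4"
      "i \<notin> Poly_Mapping.keys M" "weight e M = weight e (Poly_Mapping.single i d)" "i \<in> {1, 2} \<longrightarrow> d \<le> c"
      by (rule pure_power_exists)
    then show "\<exists>d M. 0 < d \<and> isolated e (Poly_Mapping.single i d) \<and> M \<in> monomials 4 \<and>
      i \<notin> Poly_Mapping.keys M \<and> weight e M = weight e (Poly_Mapping.single i d) \<and>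
      (i = 1 \<or> i = 2 \<longrightarrow> d \<le> c)"
      by (intro exI[of _ d] exI[of _ M]) simp
  qed
  then obtain d M where dM: "\<forall>i<4. 0 < d i \<and> isolated e (Poly_Mapping.single i (d i)) \<and>
      M i \<in> monomials 4 \<and> i \<notin> Poly_Mapping.keys (M i) \<and>
      weight e (M i) = weight e (Poly_Mapping.single i (d i)) \<and> (i = 1 \<or> i = 2 \<longrightarrow> d i \<le> c)"
    by metis
  have d: "i < 4 \<Longrightarrow> 0 < d i" "i \<in> {1, 2} \<Longrightarrow> d i \<le> c"
    and iso: "i < 4 \<Longrightarrow> isolated e (Poly_Mapping.single i (d i))"
    and M: "i < 4 \<Longrightarrow> M i \<in> monomials 4" "i < 4 \<Longrightarrow> i \<notin> Poly_Mapping.keys (M i)"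
      "i < 4 \<Longrightarrow> weight e (M i) = weight e (Poly_Mapping.single i (d i))" for i
    using spec[OF dM, of i] by auto
  define X where "X i = Poly_Mapping.single i (d i)" for i
  have XM: "isolated e (X i)" "X i \<in> monomials 4" "weight e (M i) = weight e (X i)" "M i \<noteq> X i" if "i < 4" for i
    using iso[OF that] M[OF that] d(1)[OF that] that by (auto simp: X_def)
  have X_inj: "X i \<noteq> X i'" if "i < 4" "i \<noteq> i'" for i i'
    using single_eq_single_index[of i "d i" i' "d i'"] d(1)[OF that(1)] that(2) by (auto simp: X_def)
  \<comment> \<open>Middle powers have degree at most \<open>c\<close>, so their fibres contain no
    pure power of another variable; this gives the triangularity conditions on the partners.\<close>
  have sep: "N \<noteq> X i" if "weight e N = weight e (X p)" "p \<in> {1, 2}" "i < 4" "i \<noteq> p" for N p i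
    using power_in_homogeneous_fibre[of p i "d p" "d i"] that d by (auto simp: X_def)
  have isoX: "isolated e (X 0)" "isolated e (X 1)" "isolated e (X 2)"
    by (simp_all add: XM(1))
  have X_ne: "X 0 \<noteq> X 1" "X 0 \<noteq> X 2" "X 1 \<noteq> X 2" "X 0 \<noteq> X 3" "X 1 \<noteq> X 3" "X 2 \<noteq> X 3"
    by (simp_all add: X_inj)
  have M_props: "M 0 \<in> monomials 4" "M 1 \<in> monomials 4" "M 2 \<in> monomials 4"
    "weight e (M 0) = weight e (X 0)" "weight e (M 1) = weight e (X 1)" "weight e (M 2) = weight e (X 2)"
    "X 0 \<noteq> M 0" "X 1 \<noteq> M 1" "X 2 \<noteq> M 2"
    using M(1)[of 0] M(1)[of 1] M(1)[of 2] XM(3,4)[of 0] XM(3,4)[of 1] XM(3,4)[of 2] by auto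
  have sep': "X 0 \<noteq> n" "X 2 \<noteq> n" "X 3 \<noteq> n" if "weight e n = weight e (X 1)" for n
    using sep[OF that, of 0] sep[OF that, of 2] sep[OF that, of 3] by auto
  have sep'': "X 0 \<noteq> n" "X 1 \<noteq> n" "X 3 \<noteq> n" if "weight e n = weight e (X 2)" for n
    using sep[OF that, of 0] sep[OF that, of 1] sep[OF that, of 3] by auto
  \<comment> \<open>With a third monomial \<open>m\<close> as partner of \<open>X 0\<close>, the
    indicator of \<open>X 3\<close> would agree on all three pairs and so be constant on fibres,
    although it separates \<open>X 3\<close> from \<open>M 3\<close>.\<close>
  have fibre0: "m = X 3" if m: "m \<in> monomials 4" "weight e m = weight e (X 0)" "m \<noteq> X 0" for m
  proof (rule ccontr)
    assume m3: "m \<noteq> X 3"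
    let ?\<chi> = "\<lambda>n. of_bool (n = X 3) :: 'k"
    have "fibre_functional e ?\<chi>" by (rule isolated_fibre_functional) (simp add: XM(1))
    moreover have "?\<chi> (X 0) = ?\<chi> m" using m3 X_ne by auto
    moreover have "?\<chi> (X 1) = ?\<chi> (M 1)" using X_ne sep'(3)[OF M_props(5)] by auto
    moreover have "?\<chi> (X 2) = ?\<chi> (M 2)" using X_ne sep''(3)[OF M_props(6)] by auto
    ultimately have "?\<chi> (X 3) = ?\<chi> (M 3)"
      by (rule sharp_fibre_functional_constant[OF ci isoX m(1) M_props(2,3) m(2) M_props(5,6)
            m(3)[symmetric] M_props(8,9) X_ne(1) sep'(1)[OF M_props(5)] X_ne(2) sep''(1)[OF M_props(6)]
            X_ne(3) sep''(2)[OF M_props(6)]]) (simp_all add: XM M)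
    then show False using XM(4)[of 3] by simp
  qed
  have M0: "M 0 = X 3" using fibre0[of "M 0"] M XM by simp
  then have "weight e (X 3) = weight e (X 0)" using XM(3)[of 0] by simp
  then have d03: "d 3 * (j + c) = d 0 * j" by (simp add: X_def)
  obtain i l m where o: "isolated e (outer i l)" "m \<in> monomials 4" "weight e m = weight e (outer i l)"
    "1 \<in> Poly_Mapping.keys m \<or> 2 \<in> Poly_Mapping.keys m"
    by (rule exists_isolated_outer)
  have o': "outer i l \<in> monomials 4" by simp
  have keys_o: "1 \<notin> Poly_Mapping.keys (outer i l)" "2 \<notin> Poly_Mapping.keys (outer i l)"
    by (simp_all add: in_keys_iff lookup_add lookup_single)
  \<comment> \<open>Otherwise the indicator of the outer monomial is 0 on all three pairs, yet it
    separates that monomial from \<open>m\<close>.\<close>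
  have "\<exists>p\<in>{1, 2}. weight e (outer i l) = weight e (X p)"
  proof (rule ccontr)
    assume neg: "\<not> ?thesis"
    have o0: "weight e (outer i l) \<noteq> weight e (X 0)"
    proof
      assume "weight e (outer i l) = weight e (X 0)"
      then have "m = X 0 \<or> m = X 3" using fibre0[of m] o by auto
      then show False using o(4) by (auto simp: X_def split: if_splits)
    qed
    let ?\<chi> = "\<lambda>n. of_bool (n = outer i l) :: 'k"
    have "fibre_functional e ?\<chi>" by (rule isolated_fibre_functional[OF o(1)])
    moreover have "?\<chi> (X 0) = ?\<chi> (M 0)" using o0 M_props(4) by auto
    moreover have "?\<chi> (X 1) = ?\<chi> (M 1)" using neg M_props(5) by auto
    moreover have "?\<chi> (X 2) = ?\<chi> (M 2)" using neg M_props(6) by auto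
    ultimately have "?\<chi> (outer i l) = ?\<chi> m"
      by (rule sharp_fibre_functional_constant[OF ci isoX M_props X_ne(1) sep'(1)[OF M_props(5)]
            X_ne(2) sep''(1)[OF M_props(6)] X_ne(3) sep''(2)[OF M_props(6)] _ _ _ _ o' o(2) o(3)[symmetric]])
    then show False using o(4) keys_o by auto
  qed
  then obtain p where p: "p \<in> {1, 2}" "weight e (outer i l) = weight e (X p)" by blast
  \<comment> \<open>The power of \<open>x_p\<close> gets the outer monomial as its partner; the
    other partners stay.\<close>
  define N where "N = M(p := outer i l)"
  have N: "N i \<in> monomials 4" "weight e (N i) = weight e (X i)" "N i \<noteq> X i" if "i < 4" for i
    using that p XM[OF that] M[OF that] keys_o d(1)[of p] by (auto simp: N_def X_def)
  have N_props: "N 0 \<in> monomials 4" "N 1 \<in> monomials 4" "N 2 \<in> monomials 4"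
    "weight e (N 0) = weight e (X 0)" "weight e (N 1) = weight e (X 1)" "weight e (N 2) = weight e (X 2)"
    "X 0 \<noteq> N 0" "X 1 \<noteq> N 1" "X 2 \<noteq> N 2"
    using N[of 0] N[of 1] N[of 2] by auto
  have N0: "N 0 = X 3" using p M0 by (auto simp: N_def)
  \<comment> \<open>Congruences of additive functions on fibres need only be checked on these three
    pairs.\<close>
  have invariant: "D dvd F m - F m'"
    if "\<And>m m'. F (m + m') = F m + F m'" "D dvd F (X 0) - F (X 3)" "D dvd F (X 1) - F (N 1)" "D dvd F (X 2) - F (N 2)"
      "m \<in> monomials 4" "m' \<in> monomials 4" "weight e m = weight e m'" for D m m' and F :: "_ \<Rightarrow> int"
    using that(1) that(2)[folded N0] that(3-)
    by (rule sharp_invariant[OF ci isoX N_props X_ne(1) sep'(1)[OF N_props(5)]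
            X_ne(2) sep''(1)[OF N_props(6)] X_ne(3) sep''(2)[OF N_props(6)]])
  have hom: "deg (X p) = deg (N p)" if "p \<in> {1, 2}" for p
    using that N[of p] XM[of p] d[of p] by (intro homogeneous_fibre) (auto simp: X_def)
  \<comment> \<open>The total degree changes by \<open>d 0 - d 3\<close> on the pair
    \<open>X 0\<close>, \<open>X 3\<close> and not at all on the two homogeneous middle
    pairs.\<close>
  have "j = c * d 3"
  proof (rule shift_multiple[OF d03])
    fix m m' assume "m \<in> monomials 4" "m' \<in> monomials 4" "weight e m = weight e m'"
    then show "int (d 0) - int (d 3) dvd int (deg m) - int (deg m')"
      by (rule invariant[where F="\<lambda>m. int (deg m)", rotated 4]) (simp_all add: hom, simp add: X_def)
  qed
  define q where "q = 3 - p"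
  have pq: "p = 1 \<and> q = 2 \<or> p = 2 \<and> q = 1" using p(1) by (auto simp: q_def)
  have "\<exists>k \<beta> \<gamma>. k \<noteq> 1 \<and> gcd (sh p) c = k \<and> k * sh q = \<beta> * sh p + \<gamma> * c \<and> \<beta> + \<gamma> \<le> k"
  proof (rule middle_relation[OF pq])
    show "M q \<in> monomials 4" "q \<notin> Poly_Mapping.keys (M q)"
      "weight e (M q) = weight e (Poly_Mapping.single q (d q))" "0 < d q" "d q \<le> c"
      using pq M d by auto
  next
    fix m m' assume m: "m \<in> monomials 4" "m' \<in> monomials 4" "weight e m = weight e m'"
    \<comment> \<open>Among the two middle pairs only that of \<open>x_q\<close> involves
      \<open>x_q\<close>, with exponents \<open>d q\<close> and 0.\<close>
    have middle: "int (d q) dvd int (Poly_Mapping.lookup (X i) q) - int (Poly_Mapping.lookup (N i) q)" if "i \<in> {1, 2}" for i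
    proof (cases "i = q")
      case True
      then show ?thesis using M(2)[of q] pq by (auto simp: X_def N_def in_keys_iff)
    next
      case False
      then have "i = p" using that pq by auto
      then show ?thesis using pq by (auto simp: X_def N_def lookup_add lookup_single)
    qed
    have outer: "int (Poly_Mapping.lookup (X 0) q) - int (Poly_Mapping.lookup (X 3) q) = 0"
      using pq by (auto simp: X_def lookup_single)
    show "int (d q) dvd int (Poly_Mapping.lookup m q) - int (Poly_Mapping.lookup m' q)"
      by (rule invariant[where F="\<lambda>m. int (Poly_Mapping.lookup m q)"])
        (use m outer middle[of 1] middle[of 2] in \<open>simp_all add: lookup_add\<close>)
  qed
  then obtain k \<beta> \<gamma> where k: "k \<noteq> 1" "gcd (sh p) c = k" "k * sh q = \<beta> * sh p + \<gamma> * c" "\<beta> + \<gamma> \<le> k"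
    by blast
  show ?thesis
    by (rule exI[of _ "d 3"], rule exI[of _ k], rule exI[of _ \<beta>], rule exI[of _ \<gamma>])
      (use pq k \<open>j = c * d 3\<close> in auto)
qed

end

section \<open>Sufficiency: normal forms of monomials\<close>

text \<open>The type of exponent vectors is itself a semiring under convolution, so \<open>of_nat t * m\<close> is the exponent vector of the \<open>t\<close>-th power.\<close>

lemma of_nat_mult_single:
  "of_nat t * Poly_Mapping.single i x = (Poly_Mapping.single i (t * x) :: nat \<Rightarrow>\<^sub>0 nat)"
  by (simp add: mult_single flip: single_of_nat)

lemma of_nat_mult_monomials: "m \<in> monomials n \<Longrightarrow> of_nat t * m \<in> monomials n"
  by (induction t) (auto simp: distrib_right)

lemma int_eq_of_dvd_diff:
  assumes "int n dvd int x - int y" "x < n" "y < n"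
  shows "x = y"
proof -
  have "int x mod int n = int y mod int n" using assms(1) by (simp add: mod_eq_dvd_iff)
  then show ?thesis using assms by (simp flip: of_nat_mod)
qed

text \<open>Models the relation that the difference of two monomials lies in a given ideal; the
  rewriting below uses only these four properties.\<close>

locale monomial_congruence =
  fixes R :: "(nat \<Rightarrow>\<^sub>0 nat) \<Rightarrow> (nat \<Rightarrow>\<^sub>0 nat) \<Rightarrow> bool" and n :: nat
  assumes refl: "R m m"
    and sym: "R m m' \<Longrightarrow> R m' m"
    and trans: "R m m' \<Longrightarrow> R m' m'' \<Longrightarrow> R m m''"
    and add: "u \<in> monomials n \<Longrightarrow> R m m' \<Longrightarrow> R (m + u) (m' + u)"
begin

text \<open>The \<open>t\<close> copies of \<open>m\<close> are replaced one at a time.\<close>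

lemma scale_add:
  assumes "R m m'" "m \<in> monomials n" "m' \<in> monomials n" "u \<in> monomials n"
  shows "R (of_nat t * m + u) (of_nat t * m' + u)"
proof (induction t)
  case 0
  show ?case by (simp add: refl)
next
  case (Suc t)
  let ?X = "of_nat t * m + u" and ?Y = "of_nat t * m' + u"
  have "R (m + ?X) (m' + ?X)"
    using assms by (intro add) (auto simp: of_nat_mult_monomials)
  moreover have "R (m' + ?X) (m' + ?Y)"
    using add[OF assms(3) Suc] by (simp only: add.commute[of m'])
  ultimately have "R (m + ?X) (m' + ?Y)" by (rule trans)
  then show ?case by (simp add: distrib_right add.assoc)
qed

end

text \<open>Multiplication by \<open>- 1\<close>, addition in \<open>J\<close> and multiplication by
  the monomial \<open>u\<close> give symmetry, transitivity and compatibility.\<close>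

lemma monomial_congruence_ideal:
  fixes J :: "'k::field_char_0 mpoly set"
  assumes J: "ideal J (mpoly_ring n)"
  shows "monomial_congruence (\<lambda>m m'. Poly_Mapping.single m 1 - Poly_Mapping.single m' 1 \<in> J) n"
proof
  fix m m' m'' u :: "nat \<Rightarrow>\<^sub>0 nat"
  show "Poly_Mapping.single m 1 - Poly_Mapping.single m 1 \<in> J"
    using ideal_mpolyD(1)[OF J] by simp
  show "Poly_Mapping.single m' 1 - Poly_Mapping.single m 1 \<in> J"
    if "Poly_Mapping.single m 1 - Poly_Mapping.single m' 1 \<in> J"
  proof -
    have "Poly_Mapping.single 0 (- 1) * (Poly_Mapping.single m 1 - Poly_Mapping.single m' 1) \<in> J"
      by (rule ideal_mpolyD(3)[OF J _ that]) simp
    then show ?thesis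
      by (simp add: right_diff_distrib mult_single single_uminus)
  qed
  show "Poly_Mapping.single m 1 - Poly_Mapping.single m'' 1 \<in> J"
    if "Poly_Mapping.single m 1 - Poly_Mapping.single m' 1 \<in> J"
      "Poly_Mapping.single m' 1 - Poly_Mapping.single m'' 1 \<in> J"
    using ideal_mpolyD(2)[OF J that] by simp
  show "Poly_Mapping.single (m + u) 1 - Poly_Mapping.single (m' + u) 1 \<in> J"
    if "u \<in> monomials n" "Poly_Mapping.single m 1 - Poly_Mapping.single m' 1 \<in> J"
  proof -
    have "Poly_Mapping.single u 1 * (Poly_Mapping.single m 1 - Poly_Mapping.single m' 1) \<in> J"
      using that(1) by (intro ideal_mpolyD(3)[OF J _ that(2)]) (auto simp: carrier_iff simp del: mpoly_ring_sel)
    then show ?thesis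
      by (simp add: right_diff_distrib mult_single add.commute)
  qed
qed

section \<open>Normal forms and generators for the shifted curve\<close>

context shifted_curve
begin

text \<open>As \<open>j = c * M\<close>, the equation modulo \<open>k\<close> determines
  \<open>y\<close>; after division by \<open>k\<close>, modulo \<open>n\<close>, it determines
  \<open>x\<close>; after division by \<open>c\<close>, modulo \<open>M + 1\<close>, it determines
  \<open>w\<close>; then \<open>z\<close> follows.\<close>

lemma normal_form_unique:
  assumes pq: "p = 1 \<and> q = 2 \<or> p = 2 \<and> q = 1"
    and j: "j = c * M" and k: "k = gcd (sh p) c" and n: "c = k * n"
    and bounds: "w \<le> M" "w' \<le> M" "x < n" "x' < n" "y < k" "y' < k"
    and eq: "(w + x + y + z) * j + x * sh p + y * sh q + z * c =
      (w' + x' + y' + z') * j + x' * sh p + y' * sh q + z' * c"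
  shows "w = w' \<and> x = x' \<and> y = y' \<and> z = z'"
proof -
  define sp sq where "sp = sh p" and "sq = sh q"
  have c: "0 < c" using a_pos a_less_b b_less_c by simp
  then have k0: "0 < k" using n by (cases k) auto
  obtain \<delta> where \<delta>: "sp = k * \<delta>" using k unfolding sp_def by (metis gcd_dvd1 dvdE)
  have cop: "coprime (int k) (int (sq))" "coprime (int n) (int \<delta>)"
  proof -
    have "gcd k (sq) = 1"
      using gcd_abc pq by (auto simp: k sq_def gcd.commute gcd.left_commute gcd.assoc)
    then show "coprime (int k) (int (sq))" by (simp add: coprime_iff_gcd_eq_1)
    have "k * gcd \<delta> n = k * 1" using k \<delta> n by (metis gcd_mult_distrib_nat sp_def mult_1_right)
    then have "gcd \<delta> n = 1" using k0 by simp
    then show "coprime (int n) (int \<delta>)" by (simp add: coprime_iff_gcd_eq_1 gcd.commute)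
  qed
  \<comment> \<open>The terms with \<open>j\<close> and with \<open>z\<close> are multiples of
    \<open>c\<close>; \<open>T\<close> is their difference divided by \<open>c\<close>.\<close>
  define T where "T = (int w' + int x' + int y' + int z' - int w - int x - int y - int z) * int M + int z' - int z"
  have "(int w + int x + int y + int z) * (int c * int M) + int x * int (sp) + int y * int (sq) + int z * int c =
      (int w' + int x' + int y' + int z') * (int c * int M) + int x' * int (sp) + int y' * int (sq) + int z' * int c"
    using arg_cong[OF eq, of int] by (simp add: j sp_def sq_def)
  then have main: "(int x - int x') * int (sp) + (int y - int y') * int (sq) = int c * T"
    by (simp add: T_def algebra_simps)
  then have "(int y - int y') * int (sq) = int k * (int n * T - (int x - int x') * int \<delta>)"
    by (simp add: n \<delta> algebra_simps)
  then have "int k dvd (int y - int y') * int (sq)" by simp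
  then have "int k dvd int y - int y'" using cop(1) by (simp add: coprime_dvd_mult_left_iff)
  then have y: "y = y'" using bounds by (intro int_eq_of_dvd_diff)
  then have "int k * ((int x - int x') * int \<delta>) = int k * (int n * T)"
    using main by (simp add: n \<delta> algebra_simps)
  then have x_eq: "(int x - int x') * int \<delta> = int n * T" using k0 by simp
  then have "int n dvd int x - int x'" using cop(2) by (metis coprime_dvd_mult_left_iff dvd_triv_left)
  then have x: "x = x'" using bounds by (intro int_eq_of_dvd_diff)
  have "int n * T = 0" using x_eq x by simp
  then have T: "T = 0" using c n by auto
  \<comment> \<open>\<open>M\<close> and \<open>M + 1\<close> are coprime, so \<open>w\<close> and
    \<open>w'\<close> agree modulo \<open>M + 1\<close>, and both are at most
    \<open>M\<close>.\<close>
  then have wz: "(int w - int w') * int M = (int z' - int z) * (int M + 1)"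
    by (simp add: T_def x y algebra_simps)
  have "int (M + 1) dvd (int w - int w') * int M"
    by (rule dvdI[of _ _ "int z' - int z"]) (use wz in \<open>simp add: mult.commute add.commute\<close>)
  moreover have "coprime (int (M + 1)) (int M)"
    by (metis Suc_eq_plus1 coprime_Suc_left_nat coprime_int_iff)
  ultimately have "int (M + 1) dvd int w - int w'" by (simp add: coprime_dvd_mult_left_iff)
  then have w: "w = w'" using bounds by (intro int_eq_of_dvd_diff[of "M + 1"]) simp_all
  then have "z = z'" using wz by simp
  then show ?thesis using w x y by simp
qed

text \<open>Monomials are rewritten by the rules for \<open>x_q\<close>, \<open>x_p\<close> and
  \<open>x_0\<close> in this order. Each rule creates only variables treated later or the unbounded
  \<open>x_3\<close>, so bounds once reached persist, and monomials of equal weight end in the same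
  normal form.\<close>

lemma congruence_fibre:
  assumes pq: "p = 1 \<and> q = 2 \<or> p = 2 \<and> q = 1"
    and j: "j = c * M" and k: "k = gcd (sh p) c" and n: "c = k * n"
    and R: "monomial_congruence R 4"
    and wt: "\<And>m m'. R m m' \<Longrightarrow> weight e m = weight e m'"
    and rels: "R (Poly_Mapping.single p n) (outer \<delta> \<epsilon>)"
      "R (Poly_Mapping.single q k) (outer \<alpha> \<gamma> + Poly_Mapping.single p \<beta>)"
      "R (Poly_Mapping.single 0 (M + 1)) (Poly_Mapping.single 3 M)"
    and m: "m \<in> monomials 4" "m' \<in> monomials 4" "weight e m = weight e m'"
  shows "R m m'"
proof -
  interpret monomial_congruence R 4 by (rule R)
  define f where "f w x y z = Poly_Mapping.single 0 w + Poly_Mapping.single p x + Poly_Mapping.single q y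
    + Poly_Mapping.single 3 z" for w x y z :: nat
  have p4: "p < 4" and q4: "q < 4" using pq by auto
  have fM: "f w x y z \<in> monomials 4" for w x y z using p4 q4 by (simp add: f_def)
  have c: "0 < c" using a_pos a_less_b b_less_c by simp
  then have k0: "0 < k" and n0: "0 < n" using n by (cases k; cases n; auto)+
  have red_q: "R (f w x y z) (f (w + y div k * \<alpha>) (x + y div k * \<beta>) (y mod k) (z + y div k * \<gamma>))" for w x y z
  proof -
    have "Poly_Mapping.single q y = of_nat (y div k) * Poly_Mapping.single q k + Poly_Mapping.single q (y mod k)"
      by (simp add: of_nat_mult_single flip: single_add)
    then have "f w x y z = of_nat (y div k) * Poly_Mapping.single q k + f w x (y mod k) z"
      by (simp add: f_def add_ac)
    moreover have "f (w + y div k * \<alpha>) (x + y div k * \<beta>) (y mod k) (z + y div k * \<gamma>) =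
        of_nat (y div k) * (outer \<alpha> \<gamma> + Poly_Mapping.single p \<beta>) + f w x (y mod k) z"
      by (simp add: f_def single_add of_nat_mult_single distrib_left add_ac)
    ultimately show ?thesis using scale_add[OF rels(2) _ _ fM] p4 q4 by simp
  qed
  have red_p: "R (f w x y z) (f (w + x div n * \<delta>) (x mod n) y (z + x div n * \<epsilon>))" for w x y z
  proof -
    have "Poly_Mapping.single p x = of_nat (x div n) * Poly_Mapping.single p n + Poly_Mapping.single p (x mod n)"
      by (simp add: of_nat_mult_single flip: single_add)
    then have "f w x y z = of_nat (x div n) * Poly_Mapping.single p n + f w (x mod n) y z"
      by (simp add: f_def add_ac)
    moreover have "f (w + x div n * \<delta>) (x mod n) y (z + x div n * \<epsilon>) =
        of_nat (x div n) * outer \<delta> \<epsilon> + f w (x mod n) y z"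
      by (simp add: f_def single_add of_nat_mult_single distrib_left add_ac)
    ultimately show ?thesis using scale_add[OF rels(1) _ _ fM] p4 q4 by simp
  qed
  have red_0: "R (f w x y z) (f (w mod (M + 1)) x y (z + w div (M + 1) * M))" for w x y z
  proof -
    have "Poly_Mapping.single 0 w = of_nat (w div (M + 1)) * Poly_Mapping.single 0 (M + 1)
        + Poly_Mapping.single (0::nat) (w mod (M + 1))"
      unfolding of_nat_mult_single by (simp only: div_mult_mod_eq flip: single_add)
    then have "f w x y z = of_nat (w div (M + 1)) * Poly_Mapping.single 0 (M + 1) + f (w mod (M + 1)) x y z"
      by (simp only: f_def add_ac)
    moreover have "f (w mod (M + 1)) x y (z + w div (M + 1) * M) =
        of_nat (w div (M + 1)) * Poly_Mapping.single 3 M + f (w mod (M + 1)) x y z"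
      by (simp add: f_def single_add of_nat_mult_single add_ac)
    ultimately show ?thesis using scale_add[OF rels(3) _ _ fM] by simp
  qed
  have nf: "\<exists>w x y z. R u (f w x y z) \<and> w \<le> M \<and> x < n \<and> y < k" if u: "u \<in> monomials 4" for u
  proof -
    have "u = f (Poly_Mapping.lookup u 0) (Poly_Mapping.lookup u p) (Poly_Mapping.lookup u q) (Poly_Mapping.lookup u 3)"
    proof (rule poly_mapping_eqI)
      fix i
      have "i \<in> Poly_Mapping.keys u \<Longrightarrow> i < 4" using u by (auto simp: monomials_def)
      then show "Poly_Mapping.lookup u i = Poly_Mapping.lookup (f (Poly_Mapping.lookup u 0)
          (Poly_Mapping.lookup u p) (Poly_Mapping.lookup u q) (Poly_Mapping.lookup u 3)) i"
        using less_4_cases[of i] pq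
        by (auto simp: f_def lookup_add lookup_single when_def in_keys_iff)
    qed
    then obtain w x y z where "R u (f w x y z)" using refl by metis
    then obtain w x y z where "R u (f w x y z)" "y < k"
      using red_q trans k0 by (metis mod_less_divisor)
    then obtain w x y z where "R u (f w x y z)" "y < k" "x < n"
      using red_p trans n0 by (metis mod_less_divisor)
    then have "R u (f (w mod (M + 1)) x y (z + w div (M + 1) * M)) \<and> w mod (M + 1) \<le> M \<and> x < n \<and> y < k"
      using red_0 trans by (metis Suc_eq_plus1 less_Suc_eq_le mod_less_divisor zero_less_Suc)
    then show ?thesis by blast
  qed
  obtain w x y z where 1: "R m (f w x y z)" "w \<le> M" "x < n" "y < k" using nf[OF m(1)] by blast
  obtain w' x' y' z' where 2: "R m' (f w' x' y' z')" "w' \<le> M" "x' < n" "y' < k" using nf[OF m(2)] by blast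
  have wf: "weight e (f w x y z) = (w + x + y + z) * j + x * sh p + y * sh q + z * c" for w x y z
    using p4 q4 by (subst weight_e[OF fM]) (simp add: f_def)
  have "weight e (f w x y z) = weight e (f w' x' y' z')" using wt[OF 1(1)] wt[OF 2(1)] m(3) by simp
  then have "w = w' \<and> x = x' \<and> y = y' \<and> z = z'"
    unfolding wf by (rule normal_form_unique[OF pq j k n 1(2) 2(2) 1(3) 2(3) 1(4) 2(4)])
  then show ?thesis using trans[OF 1(1), of m'] sym[OF 2(1)] by simp
qed

text \<open>The generators are two homogeneous binomials, with leading powers \<open>x_p^n\<close>
  (where \<open>n = c / k\<close>) and \<open>x_q^k\<close>, and \<open>x_0^(M + 1) - x_3^M\<close>,
  which has equal weights because \<open>j = c * M\<close>.\<close>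

lemma ci_sequenceI:
  assumes pq: "p = 1 \<and> q = 2 \<or> p = 2 \<and> q = 1"
    and j: "j = c * M" and k: "gcd (sh p) c = k" and rel: "k * sh q = \<beta> * sh p + \<gamma> * c" and le: "\<beta> + \<gamma> \<le> k"
  shows "ci_sequence TYPE('k::field_char_0) e"
proof -
  have p4: "p < 4" and q4: "q < 4" using pq by auto
  obtain n where n: "c = k * n" using k by (metis gcd_dvd2 dvdE)
  obtain \<epsilon> where \<epsilon>: "sh p = k * \<epsilon>" using k by (metis gcd_dvd1 dvdE)
  have c: "0 < c" using a_pos a_less_b b_less_c by simp
  have "k * \<epsilon> \<le> k * n" using sh_le[OF p4] by (simp only: flip: n \<epsilon>)
  then have "\<epsilon> \<le> n" using c n by auto
  have n_eq: "n * (k * \<epsilon>) = \<epsilon> * c" by (subst n) simp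
  \<comment> \<open>Exponents of \<open>x_0\<close> that make the first two binomials homogeneous;
    the natural subtractions are exact because \<open>\<beta> + \<gamma> \<le> k\<close> and
    \<open>\<epsilon> \<le> n\<close>.\<close>
  define \<alpha> \<delta> where "\<alpha> = k - \<beta> - \<gamma>" and "\<delta> = n - \<epsilon>"
  define P where "P = [Poly_Mapping.single p n, Poly_Mapping.single q k, Poly_Mapping.single 0 (M + 1)]"
  define Q where "Q = [outer \<delta> \<epsilon>, outer \<alpha> \<gamma> + Poly_Mapping.single p \<beta>, Poly_Mapping.single (3::nat) M]"
  define gs where "gs = map2 (\<lambda>m m'. Poly_Mapping.single m (1::'k) - Poly_Mapping.single m' 1) P Q"
  let ?R = "mpoly_ring 4 :: 'k mpoly ring" and ?I = "defining_ideal e :: 'k mpoly set"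
  interpret R: cring ?R by (rule cring_mpoly_ring)
  have jM: "(M + 1) * j = M * (j + c)" using j by (simp add: algebra_simps)
  have bin: "Poly_Mapping.single m 1 - Poly_Mapping.single m' 1 \<in> ?I"
    if "m \<in> monomials 4" "m' \<in> monomials 4" "deg m = deg m'" "shift m = shift m'" for m m'
    using that by (intro binomial_in_defining_ideal) (simp_all add: weight_e)
  have "Poly_Mapping.single (Poly_Mapping.single p n) 1 - Poly_Mapping.single (outer \<delta> \<epsilon>) 1 \<in> ?I"
    using p4 \<open>\<epsilon> \<le> n\<close> by (intro bin) (simp_all add: \<delta>_def \<epsilon> n_eq)
  moreover have "Poly_Mapping.single (Poly_Mapping.single q k) 1
      - Poly_Mapping.single (outer \<alpha> \<gamma> + Poly_Mapping.single p \<beta>) 1 \<in> ?I"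
    using p4 q4 le rel by (intro bin) (simp_all add: \<alpha>_def)
  moreover have "Poly_Mapping.single (Poly_Mapping.single 0 (M + 1)) 1
      - Poly_Mapping.single (Poly_Mapping.single 3 M) 1 \<in> ?I"
    using jM by (intro binomial_in_defining_ideal) simp_all
  ultimately have gsI: "set gs \<subseteq> ?I" by (simp add: gs_def P_def Q_def)
  then have gsR: "set gs \<subseteq> carrier ?R" by (auto simp: defining_ideal_def simp del: mpoly_ring_sel)
  define J where "J = Idl\<^bsub>?R\<^esub> (set gs)"
  have idealI: "ideal ?I ?R" using ideal_defining_ideal[of e] by simp
  have J: "ideal J ?R" unfolding J_def by (rule R.genideal_ideal[OF gsR])
  have JI: "J \<subseteq> ?I" unfolding J_def by (rule R.genideal_minimal[OF idealI gsI])
  have gsJ: "set gs \<subseteq> J" unfolding J_def by (rule R.genideal_self[OF gsR])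
  have "?I \<subseteq> J"
  proof (rule defining_ideal_subset_ideal)
    show "ideal J (mpoly_ring (length e))" using J by simp
    fix m m' assume "m \<in> monomials (length e)" "m' \<in> monomials (length e)" "weight e m = weight e m'"
    then have m: "m \<in> monomials 4" "m' \<in> monomials 4" "weight e m = weight e m'" by simp_all
    show "Poly_Mapping.single m 1 - Poly_Mapping.single m' 1 \<in> J"
    proof (rule congruence_fibre[OF pq j k[symmetric] n monomial_congruence_ideal[OF J] _ _ _ _ m,
          where \<alpha>=\<alpha> and \<beta>=\<beta> and \<gamma>=\<gamma> and \<delta>=\<delta> and \<epsilon>=\<epsilon>])
      fix u u' assume "Poly_Mapping.single u (1::'k) - Poly_Mapping.single u' 1 \<in> J"
      then have "curve_map e (Poly_Mapping.single u (1::'k) - Poly_Mapping.single u' 1) = 0"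
        using JI by (auto simp: defining_ideal_def)
      then have "monom (1::'k) (weight e u) = monom 1 (weight e u')"
        by (simp add: curve_map_diff curve_map_monomial)
      then show "weight e u = weight e u'" by (metis degree_monom_eq one_neq_zero)
    qed (use gsJ in \<open>simp_all add: gs_def P_def Q_def\<close>)
  qed
  then have "?I = J" using JI by blast
  moreover have "length gs = 3" by (simp add: gs_def P_def Q_def)
  moreover have "sorted_wrt (<) e" using a_pos a_less_b b_less_c by (simp add: e_def)
  ultimately show ?thesis
    unfolding ci_sequence_def using e_pos gsR
    by (intro conjI exI[of _ gs]) (auto simp: J_def simp del: mpoly_ring_sel, simp add: e_def)
qed

lemma ci_sequence_iff:
  "ci_sequence TYPE('k::field_char_0) e \<longleftrightarrow> (\<exists>m k \<beta> \<gamma>. j = c * m \<and> k \<noteq> 1 \<and>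
       ((gcd b c = k \<and> k * a = \<beta> * b + \<gamma> * c) \<or>
        (gcd a c = k \<and> k * b = \<beta> * a + \<gamma> * c \<and> \<beta> + \<gamma> \<le> k)))"
proof
  assume "\<exists>m k \<beta> \<gamma>. j = c * m \<and> k \<noteq> 1 \<and>
       ((gcd b c = k \<and> k * a = \<beta> * b + \<gamma> * c) \<or>
        (gcd a c = k \<and> k * b = \<beta> * a + \<gamma> * c \<and> \<beta> + \<gamma> \<le> k))"
  then obtain m k \<beta> \<gamma> where j: "j = c * m"
    and or: "(gcd b c = k \<and> k * a = \<beta> * b + \<gamma> * c) \<or>
        (gcd a c = k \<and> k * b = \<beta> * a + \<gamma> * c \<and> \<beta> + \<gamma> \<le> k)" by blast
  from or show "ci_sequence TYPE('k) e"
  proof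
    assume *: "gcd b c = k \<and> k * a = \<beta> * b + \<gamma> * c"
    \<comment> \<open>In this case the degree bound \<open>\<beta> + \<gamma> \<le> k\<close>
      follows from \<open>a\<close> being the smallest offset.\<close>
    have "(\<beta> + \<gamma>) * a \<le> \<beta> * b + \<gamma> * c"
      using a_less_b b_less_c by (simp add: add_mult_distrib add_mono)
    then have "\<beta> + \<gamma> \<le> k" using * a_pos by (metis mult_le_cancel2)
    then show ?thesis using ci_sequenceI[of 2 1 m k \<beta> \<gamma>] * j by simp
  next
    assume "gcd a c = k \<and> k * b = \<beta> * a + \<gamma> * c \<and> \<beta> + \<gamma> \<le> k"
    then show ?thesis using ci_sequenceI[of 1 2 m k \<beta> \<gamma>] j by simp
  qed
qed (rule ci_sequence_imp)

end

theorem theorem2p4: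
  fixes a b c :: nat
  assumes "0 < a" "a < b" "b < c"
    and "gcd a (gcd b c) = 1"
  shows "\<exists>N::nat. \<forall>j\<ge>N.
    ci_sequence TYPE('k::field_char_0) [j, j + a, j + b, j + c] \<longleftrightarrow>
    (\<exists>m k \<beta> \<gamma> :: nat.
       j = c * m \<and> k \<noteq> 1 \<and>
       ((gcd b c = k \<and> k * a = \<beta> * b + \<gamma> * c) \<or>
        (gcd a c = k \<and> k * b = \<beta> * a + \<gamma> * c \<and> \<beta> + \<gamma> \<le> k)))"
proof (intro exI[of _ "c * c + 1"] allI impI)
  fix j assume "c * c + 1 \<le> j"
  \<comment> \<open>The threshold \<open>c * c + 1\<close> is exactly the strict bound
    \<open>c * c < j\<close> under which low-degree fibres are homogeneous.\<close>
  then interpret shifted_curve a b c j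
    using assms by unfold_locales auto
  show "ci_sequence TYPE('k) [j, j + a, j + b, j + c] \<longleftrightarrow>
    (\<exists>m k \<beta> \<gamma> :: nat.
       j = c * m \<and> k \<noteq> 1 \<and>
       ((gcd b c = k \<and> k * a = \<beta> * b + \<gamma> * c) \<or>
        (gcd a c = k \<and> k * b = \<beta> * a + \<gamma> * c \<and> \<beta> + \<gamma> \<le> k)))"
    using ci_sequence_iff unfolding e_def .
qed

end
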